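(* Let $X$ be a (smooth) Fano toric variety with fan edges $e_1,\dots,e_r\in\mathbb{Z}^n$. For a generic choice of toric symplectic form $\omega_F$ (meaning, after a generic small perturbation of the values $F(e_i)\in\mathbb{R}$), the twisted superpotential $W_F$ is Morse and its critical values are all distinct and non-zero.
   Context: Toric symplectic forms on $X$ correspond to piecewise linear, strictly convex functions $F$ on the fan (real-valued and linear on each cone; if $F=\langle u_\sigma,\cdot\rangle$ on the cone $\sigma$, strict convexity means $\langle u_\sigma,v\rangle>F(v)$ for $v\notin\sigma$). The form $\omega_F$ is a Kähler form for the given complex structure with $[\omega_F]=\sum-F(e_i)\mathrm{PD}[D_i]$, $D_i$ the toric divisors, and its moment polytope is $\{y\in\mathbb{R}^n:\langle y,e_i\rangle\ge F(e_i)\}$. The values $F(e_i)=-1$ for all $i$ correspond to the monotone form in class $c_1(TX)$; $F$ is taken near this (monotone) choice. Coefficients: $\Lambda_s=\{\sum a_is^{n_i}:a_i\in\mathbb{K},n_i\in\mathbb{R},n_i\to\infty\}$ and $\mathfrak{R}=\Lambda_s((T))$, Laurent series in $T$. The twisted superpotential is $$W_F:(\mathfrak{R}\setminus\{0\})^n\to\mathfrak{R},\qquad W_F(z)=\sum_{i=1}^rs^{-F(e_i)}T\,z^{e_i}.$$ "Morse" means all critical points of $W_F$ are non-degenerate. Critical values are the values $W_F(p)$ at critical points $p$; "distinct" means different critical points have different critical values.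
   Formalization: The coefficient field K, left unspecified in the source, is taken to have characteristic 0; in characteristic p the claim fails, e.g. for projective space of dimension p-1, where a critical value is p times a monomial, hence zero. *)

theory Defs
  imports
    "HOL-Analysis.Analysis"
    "HOL-Computational_Algebra.Formal_Laurent_Series"
    "HOL-Library.Poly_Mapping"
begin

section \<open>The field of generalised power series in \<open>s\<close> with real exponents\<close>

text \<open>
  A series with coefficients in \<open>'k\<close> and exponents tending to infinity is encoded by its
  coefficient function; only finitely many exponents lie below any given bound.
\<close>

typedef (overloaded) 'k::zero novikov =
  "{f :: real \<Rightarrow> 'k. \<forall>c. finite {x. f x \<noteq> 0 \<and> x \<le> c}}"
  morphisms nov_coeff Abs_novikov
  by (rule exI[of _ "\<lambda>_. 0"]) auto

setup_lifting type_definition_novikov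

lemma novikov_eqI: "(\<And>x. nov_coeff f x = nov_coeff g x) \<Longrightarrow> f = g"
  by transfer auto

lemma nov_finite: "finite {x. nov_coeff f x \<noteq> 0 \<and> x \<le> c}"
  by transfer auto

lemma locfin_bdd_below:
  fixes f :: "real \<Rightarrow> 'k::zero"
  assumes "\<forall>c. finite {x. f x \<noteq> 0 \<and> x \<le> c}"
  obtains b where "\<And>x. f x \<noteq> 0 \<Longrightarrow> b \<le> x"
proof -
  let ?S = "insert 0 {x. f x \<noteq> 0 \<and> x \<le> 0}"
  have fin: "finite ?S" using assms by auto
  have "Min ?S \<le> x" if "f x \<noteq> 0" for x
  proof (cases "x \<le> 0")
    case True
    then show ?thesis using that fin by (intro Min_le) auto
  next
    case False
    moreover have "Min ?S \<le> 0" using fin by (intro Min_le) auto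
    ultimately show ?thesis by linarith
  qed
  then show thesis using that by blast
qed

lemma nov_bdd_below:
  obtains b where "\<And>x. nov_coeff f x \<noteq> 0 \<Longrightarrow> b \<le> x"
proof -
  have "\<forall>c. finite {x. nov_coeff f x \<noteq> 0 \<and> x \<le> c}" by (simp add: nov_finite)
  from locfin_bdd_below[OF this] that show thesis by metis
qed

definition nov_conv :: "(real \<Rightarrow> 'k::comm_ring_1) \<Rightarrow> (real \<Rightarrow> 'k) \<Rightarrow> real \<Rightarrow> 'k" where
  "nov_conv f g x = (\<Sum>y | f y \<noteq> 0 \<and> g (x - y) \<noteq> 0. f y * g (x - y))"

lemma nov_conv_eq:
  assumes "finite A" and "\<And>y. f y \<noteq> 0 \<Longrightarrow> g (x - y) \<noteq> 0 \<Longrightarrow> y \<in> A"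
  shows "nov_conv f g x = (\<Sum>y\<in>A. f y * g (x - y))"
  unfolding nov_conv_def using assms by (intro sum.mono_neutral_left) auto

lemma nov_conv_nonzero:
  assumes "nov_conv f g x \<noteq> 0"
  shows "\<exists>y. f y \<noteq> 0 \<and> g (x - y) \<noteq> 0"
proof (rule ccontr)
  assume "\<not> ?thesis"
  then have "{y. f y \<noteq> 0 \<and> g (x - y) \<noteq> 0} = {}" by blast
  then show False using assms unfolding nov_conv_def by (metis sum.empty)
qed

lemma nov_conv_locfin:
  fixes f g :: "real \<Rightarrow> 'k::comm_ring_1"
  assumes f: "\<forall>c. finite {x. f x \<noteq> 0 \<and> x \<le> c}"
    and g: "\<forall>c. finite {x. g x \<noteq> 0 \<and> x \<le> c}"
  shows "finite {x. nov_conv f g x \<noteq> 0 \<and> x \<le> c}"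
proof -
  obtain bf where bf: "\<And>x. f x \<noteq> 0 \<Longrightarrow> bf \<le> x" using locfin_bdd_below[OF f] by metis
  obtain bg where bg: "\<And>x. g x \<noteq> 0 \<Longrightarrow> bg \<le> x" using locfin_bdd_below[OF g] by metis
  let ?A = "{x. f x \<noteq> 0 \<and> x \<le> c - bg}" and ?B = "{x. g x \<noteq> 0 \<and> x \<le> c - bf}"
  have "{x. nov_conv f g x \<noteq> 0 \<and> x \<le> c} \<subseteq> (\<lambda>(a, b). a + b) ` (?A \<times> ?B)"
  proof
    fix x assume x: "x \<in> {x. nov_conv f g x \<noteq> 0 \<and> x \<le> c}"
    then have "\<exists>y. f y \<noteq> 0 \<and> g (x - y) \<noteq> 0" by (intro nov_conv_nonzero) simp
    then obtain y where y: "f y \<noteq> 0" "g (x - y) \<noteq> 0" by blast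
    have "(y, x - y) \<in> ?A \<times> ?B" using y bf[OF y(1)] bg[OF y(2)] x by auto
    then show "x \<in> (\<lambda>(a, b). a + b) ` (?A \<times> ?B)" by (intro image_eqI[of _ _ "(y, x - y)"]) auto
  qed
  moreover have "finite (?A \<times> ?B)" using f g by auto
  ultimately show ?thesis by (meson finite_surj)
qed

instantiation novikov :: (comm_ring_1) comm_ring_1
begin

lift_definition zero_novikov :: "'a novikov" is "\<lambda>_. 0" by simp

lift_definition one_novikov :: "'a novikov" is "\<lambda>x. if x = 0 then 1 else 0"
  by (rule finite_subset[of _ "{0}"]) auto

lift_definition plus_novikov :: "'a novikov \<Rightarrow> 'a novikov \<Rightarrow> 'a novikov" is "\<lambda>f g x. f x + g x"
proof -
  fix f g :: "real \<Rightarrow> 'a" and c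
  assume "\<And>c. finite {x. f x \<noteq> 0 \<and> x \<le> c}" "\<And>c. finite {x. g x \<noteq> 0 \<and> x \<le> c}"
  then have "finite ({x. f x \<noteq> 0 \<and> x \<le> c} \<union> {x. g x \<noteq> 0 \<and> x \<le> c})" by blast
  then show "finite {x. f x + g x \<noteq> 0 \<and> x \<le> c}" by (rule rev_finite_subset) auto
qed

lift_definition uminus_novikov :: "'a novikov \<Rightarrow> 'a novikov" is "\<lambda>f x. - f x" by simp

definition minus_novikov :: "'a novikov \<Rightarrow> 'a novikov \<Rightarrow> 'a novikov" where
  "minus_novikov f g = f + (- g)"

lift_definition times_novikov :: "'a novikov \<Rightarrow> 'a novikov \<Rightarrow> 'a novikov" is nov_conv
  by (rule nov_conv_locfin) auto

lemma nov_mult_eq: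
  assumes "finite A" and "\<And>y. nov_coeff f y \<noteq> 0 \<Longrightarrow> nov_coeff g (x - y) \<noteq> 0 \<Longrightarrow> y \<in> A"
  shows "nov_coeff (f * g) x = (\<Sum>y\<in>A. nov_coeff f y * nov_coeff g (x - y))"
  using nov_conv_eq[of A "nov_coeff f" "nov_coeff g" x] assms by (simp add: times_novikov.rep_eq)

lemma nov_mult_commute: "f * g = g * (f :: 'a novikov)"
proof (rule novikov_eqI)
  fix x
  have "nov_conv (nov_coeff f) (nov_coeff g) x = nov_conv (nov_coeff g) (nov_coeff f) x"
    unfolding nov_conv_def
    by (rule sum.reindex_bij_witness[of _ "\<lambda>y. x - y" "\<lambda>y. x - y"]) (auto simp: mult.commute)
  then show "nov_coeff (f * g) x = nov_coeff (g * f) x" by (simp add: times_novikov.rep_eq)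
qed

lemma nov_mult_assoc: "f * g * h = f * (g * (h :: 'a novikov))"
proof (rule novikov_eqI)
  fix x
  obtain bf where bf: "\<And>x. nov_coeff f x \<noteq> 0 \<Longrightarrow> bf \<le> x" using nov_bdd_below by metis
  obtain bg where bg: "\<And>x. nov_coeff g x \<noteq> 0 \<Longrightarrow> bg \<le> x" using nov_bdd_below by metis
  obtain bh where bh: "\<And>x. nov_coeff h x \<noteq> 0 \<Longrightarrow> bh \<le> x" using nov_bdd_below by metis
  define A where "A = {y. nov_coeff f y \<noteq> 0 \<and> y \<le> x - bg - bh}"
  define C where "C = {y. nov_coeff h y \<noteq> 0 \<and> y \<le> x - bf - bg}"
  have fin: "finite A" "finite C" unfolding A_def C_def by (rule nov_finite)+
  have prodnz: "\<exists>y. nov_coeff p y \<noteq> 0 \<and> nov_coeff q (z - y) \<noteq> 0"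
    if "nov_coeff (p * q) z \<noteq> 0" for p q :: "'a novikov" and z
    using that unfolding times_novikov.rep_eq by (rule nov_conv_nonzero)
  have "nov_coeff (f * g * h) x = nov_coeff (h * (f * g)) x" by (simp add: nov_mult_commute)
  also have "\<dots> = (\<Sum>c\<in>C. nov_coeff h c * nov_coeff (f * g) (x - c))"
  proof (rule nov_mult_eq[OF fin(2)])
    fix y assume y: "nov_coeff h y \<noteq> 0" "nov_coeff (f * g) (x - y) \<noteq> 0"
    from prodnz[OF y(2)] obtain u where "nov_coeff f u \<noteq> 0" "nov_coeff g (x - y - u) \<noteq> 0" by blast
    from bf[OF this(1)] bg[OF this(2)] show "y \<in> C" using y unfolding C_def by auto
  qed
  also have "\<dots> = (\<Sum>c\<in>C. nov_coeff h c * (\<Sum>a\<in>A. nov_coeff f a * nov_coeff g (x - c - a)))"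
  proof (rule sum.cong[OF refl])
    fix c assume "c \<in> C"
    then have "bh \<le> c" using bh unfolding C_def by auto
    then have "nov_coeff (f * g) (x - c) = (\<Sum>a\<in>A. nov_coeff f a * nov_coeff g (x - c - a))"
      by (intro nov_mult_eq[OF fin(1)]) (use bg in \<open>force simp: A_def\<close>)
    then show "nov_coeff h c * nov_coeff (f * g) (x - c) =
        nov_coeff h c * (\<Sum>a\<in>A. nov_coeff f a * nov_coeff g (x - c - a))" by simp
  qed
  also have "\<dots> = (\<Sum>c\<in>C. \<Sum>a\<in>A. nov_coeff f a * (nov_coeff h c * nov_coeff g (x - a - c)))"
    by (simp add: sum_distrib_left algebra_simps)
  also have "\<dots> = (\<Sum>a\<in>A. nov_coeff f a * (\<Sum>c\<in>C. nov_coeff h c * nov_coeff g (x - a - c)))"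
    by (subst sum.swap) (simp add: sum_distrib_left)
  also have "\<dots> = (\<Sum>a\<in>A. nov_coeff f a * nov_coeff (h * g) (x - a))"
  proof (rule sum.cong[OF refl])
    fix a assume "a \<in> A"
    then have "bf \<le> a" using bf unfolding A_def by auto
    then have "nov_coeff (h * g) (x - a) = (\<Sum>c\<in>C. nov_coeff h c * nov_coeff g (x - a - c))"
      by (intro nov_mult_eq[OF fin(2)]) (use bg in \<open>force simp: C_def\<close>)
    then show "nov_coeff f a * (\<Sum>c\<in>C. nov_coeff h c * nov_coeff g (x - a - c)) =
        nov_coeff f a * nov_coeff (h * g) (x - a)" by simp
  qed
  also have "\<dots> = nov_coeff (f * (h * g)) x"
  proof (rule nov_mult_eq[OF fin(1), symmetric])
    fix y assume y: "nov_coeff f y \<noteq> 0" "nov_coeff (h * g) (x - y) \<noteq> 0"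
    from prodnz[OF y(2)] obtain u where "nov_coeff h u \<noteq> 0" "nov_coeff g (x - y - u) \<noteq> 0" by blast
    from bh[OF this(1)] bg[OF this(2)] show "y \<in> A" using y unfolding A_def by auto
  qed
  finally show "nov_coeff (f * g * h) x = nov_coeff (f * (g * h)) x"
    by (simp add: nov_mult_commute[of g h])
qed

lemma nov_mult_1: "1 * f = (f :: 'a novikov)"
proof (rule novikov_eqI)
  fix x
  have "nov_coeff (1 * f) x = (\<Sum>y\<in>{0}. nov_coeff 1 y * nov_coeff f (x - y))"
    by (rule nov_mult_eq) (auto simp: one_novikov.rep_eq split: if_splits)
  then show "nov_coeff (1 * f) x = nov_coeff f x" by (simp add: one_novikov.rep_eq)
qed

lemma nov_distrib: "(f + g) * h = f * h + g * (h :: 'a novikov)"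
proof (rule novikov_eqI)
  fix x
  obtain bh where bh: "\<And>x. nov_coeff h x \<noteq> 0 \<Longrightarrow> bh \<le> x" using nov_bdd_below by metis
  define A where "A = {y. nov_coeff f y \<noteq> 0 \<and> y \<le> x - bh} \<union> {y. nov_coeff g y \<noteq> 0 \<and> y \<le> x - bh}"
  have fin: "finite A" unfolding A_def by (simp add: nov_finite)
  have A: "y \<in> A" if "nov_coeff f y \<noteq> 0 \<or> nov_coeff g y \<noteq> 0" "nov_coeff h (x - y) \<noteq> 0" for y
    using that bh[OF that(2)] unfolding A_def by auto
  have "nov_coeff ((f + g) * h) x = (\<Sum>y\<in>A. nov_coeff (f + g) y * nov_coeff h (x - y))"
    by (rule nov_mult_eq[OF fin]) (rule A, auto simp: plus_novikov.rep_eq)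
  moreover have "nov_coeff (f * h) x = (\<Sum>y\<in>A. nov_coeff f y * nov_coeff h (x - y))"
    by (rule nov_mult_eq[OF fin]) (rule A, auto)
  moreover have "nov_coeff (g * h) x = (\<Sum>y\<in>A. nov_coeff g y * nov_coeff h (x - y))"
    by (rule nov_mult_eq[OF fin]) (rule A, auto)
  ultimately show "nov_coeff ((f + g) * h) x = nov_coeff (f * h + g * h) x"
    by (simp add: plus_novikov.rep_eq sum.distrib algebra_simps)
qed

instance
proof
  fix a b c :: "'a novikov"
  show "a * b * c = a * (b * c)" by (rule nov_mult_assoc)
  show "a * b = b * a" by (rule nov_mult_commute)
  show "1 * a = a" by (rule nov_mult_1)
  show "(a + b) * c = a * c + b * c" by (rule nov_distrib)
  show "a - b = a + - b" by (rule minus_novikov_def)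
  show "a + b + c = a + (b + c)" by transfer (simp add: add.assoc)
  show "a + b = b + a" by transfer (simp add: add.commute)
  show "0 + a = a" by transfer simp
  show "- a + a = 0" by transfer simp
  show "(0 :: 'a novikov) \<noteq> 1" by transfer (metis zero_neq_one)
qed

end

lemma nov_coeff_minus: "nov_coeff (f - g) x = nov_coeff f x - nov_coeff (g :: 'k::comm_ring_1 novikov) x"
  unfolding minus_novikov_def plus_novikov.rep_eq uminus_novikov.rep_eq by simp

lemma nov_coeff_sum:
  "nov_coeff (\<Sum>i\<in>I. f i) x = (\<Sum>i\<in>I. nov_coeff (f i :: 'k::comm_ring_1 novikov) x)"
  by (induction I rule: infinite_finite_induct) (auto simp: zero_novikov.rep_eq plus_novikov.rep_eq)

lift_definition nov_monom :: "'k::zero \<Rightarrow> real \<Rightarrow> 'k novikov" is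
  "\<lambda>a v x. if x = v then a else 0"
  subgoal for a v c by (rule finite_subset[of _ "{v}"]) auto
  done

lemma nov_monom_mult_coeff:
  "nov_coeff (nov_monom a v * f) x = a * nov_coeff (f :: 'k::comm_ring_1 novikov) (x - v)"
proof -
  have "nov_coeff (nov_monom a v * f) x = (\<Sum>y\<in>{v}. nov_coeff (nov_monom a v) y * nov_coeff f (x - y))"
    by (rule nov_mult_eq) (auto simp: nov_monom.rep_eq split: if_splits)
  then show ?thesis by (simp add: nov_monom.rep_eq)
qed

lemma nov_monom_mult:
  "nov_monom a v * nov_monom b w = nov_monom (a * b :: 'k::comm_ring_1) (v + w)"
  by (rule novikov_eqI) (auto simp: nov_monom_mult_coeff, auto simp: nov_monom.rep_eq)

lemma nov_monom_one: "nov_monom 1 0 = (1 :: 'k::comm_ring_1 novikov)"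
  by (rule novikov_eqI) (simp add: nov_monom.rep_eq one_novikov.rep_eq)

abbreviation s_powr :: "real \<Rightarrow> 'k::comm_ring_1 novikov" where
  "s_powr v \<equiv> nov_monom 1 v"

lemma nov_mult_supp_ge:
  assumes "\<And>x. nov_coeff f x \<noteq> 0 \<Longrightarrow> a \<le> x" and "\<And>x. nov_coeff g x \<noteq> 0 \<Longrightarrow> b \<le> x"
    and "nov_coeff (f * g) x \<noteq> (0 :: 'k::comm_ring_1)"
  shows "a + b \<le> x"
proof -
  have "\<exists>y. nov_coeff f y \<noteq> 0 \<and> nov_coeff g (x - y) \<noteq> 0"
    using assms(3) unfolding times_novikov.rep_eq by (rule nov_conv_nonzero)
  then obtain y where "nov_coeff f y \<noteq> 0" "nov_coeff g (x - y) \<noteq> 0" by blast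
  from assms(1)[OF this(1)] assms(2)[OF this(2)] show ?thesis by linarith
qed

lemma nov_geometric:
  fixes g :: "'k::comm_ring_1 novikov"
  assumes d: "d > 0" and g: "\<And>x. nov_coeff g x \<noteq> 0 \<Longrightarrow> d \<le> x"
  shows "\<exists>h. (1 - g) * h = 1"
proof -
  have pw: "real n * d \<le> x" if "nov_coeff (g ^ n) x \<noteq> 0" for n x
    using that
  proof (induction n arbitrary: x)
    case 0
    then show ?case by (auto simp: one_novikov.rep_eq split: if_splits)
  next
    case (Suc n)
    have "d + real n * d \<le> x"
      by (rule nov_mult_supp_ge[of g d "g ^ n" "real n * d" x]) (use g Suc in auto)
    then show ?case by (simp add: algebra_simps)
  qed
  define S where "S N = (\<Sum>n\<le>N. g ^ n)" for N :: nat
  define N where "N x = nat \<lceil>x / d\<rceil>" for x :: real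
  have Nx: "x \<le> real (N x) * d" for x
    unfolding N_def using d by (metis pos_divide_le_eq real_nat_ceiling_ge)
  have stab: "nov_coeff (S M) x = nov_coeff (S (N c)) x" if "x \<le> c" "N c \<le> M" for x c M
  proof -
    have "nov_coeff (g ^ n) x = 0" if "n \<in> {..M} - {..N c}" for n
    proof (rule ccontr)
      assume "nov_coeff (g ^ n) x \<noteq> 0"
      then have "real n * d \<le> x" by (rule pw)
      moreover have "real (N c) * d < real n * d" using that d by auto
      ultimately show False using Nx[of c] \<open>x \<le> c\<close> by linarith
    qed
    then show ?thesis unfolding S_def nov_coeff_sum
      using \<open>N c \<le> M\<close> by (intro sum.mono_neutral_right) auto
  qed
  have Nmono: "N x \<le> N c" if "x \<le> c" for x c
    unfolding N_def using d that by (intro nat_mono ceiling_mono divide_right_mono) auto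
  define h where "h = Abs_novikov (\<lambda>x. nov_coeff (S (N x)) x)"
  have "finite {x. nov_coeff (S (N x)) x \<noteq> 0 \<and> x \<le> c}" for c
  proof -
    have "{x. nov_coeff (S (N x)) x \<noteq> 0 \<and> x \<le> c} \<subseteq> {x. nov_coeff (S (N c)) x \<noteq> 0 \<and> x \<le> c}"
    proof
      fix x assume x: "x \<in> {x. nov_coeff (S (N x)) x \<noteq> 0 \<and> x \<le> c}"
      then have "nov_coeff (S (N c)) x = nov_coeff (S (N x)) x"
        by (intro stab[OF order_refl Nmono]) simp
      then show "x \<in> {x. nov_coeff (S (N c)) x \<noteq> 0 \<and> x \<le> c}" using x by simp
    qed
    then show ?thesis using nov_finite finite_subset by blast
  qed
  then have hc: "nov_coeff h x = nov_coeff (S (N x)) x" for x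
    unfolding h_def by (subst Abs_novikov_inverse) auto
  have "(1 - g) * h = 1"
  proof (rule novikov_eqI)
    fix c
    have supp: "0 \<le> y" if "nov_coeff (1 - g) y \<noteq> 0" for y
    proof (rule ccontr)
      assume "\<not> 0 \<le> y"
      with that g[of y] d show False
        by (auto simp: nov_coeff_minus one_novikov.rep_eq)
    qed
    define M where "M = Suc (N c)"
    have hS: "nov_coeff h x = nov_coeff (S M) x" if "x \<le> c" for x
      using stab[of x x M] Nmono[OF that] by (simp add: hc M_def)
    define A where "A = {y. nov_coeff (1 - g) y \<noteq> 0 \<and> nov_coeff h (c - y) \<noteq> 0}"
    have "nov_coeff ((1 - g) * h) c = nov_coeff ((1 - g) * S M) c"
    proof -
      have "nov_coeff (1 - g) y * nov_coeff h (c - y) = nov_coeff (1 - g) y * nov_coeff (S M) (c - y)" for y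
        using supp[of y] hS[of "c - y"] by (cases "nov_coeff (1 - g) y = 0") auto
      moreover have "{y. nov_coeff (1 - g) y \<noteq> 0 \<and> nov_coeff h (c - y) \<noteq> 0} =
          {y. nov_coeff (1 - g) y \<noteq> 0 \<and> nov_coeff (S M) (c - y) \<noteq> 0}"
        using supp hS by fastforce
      ultimately show ?thesis unfolding times_novikov.rep_eq nov_conv_def by simp
    qed
    also have "(1 - g) * S M = 1 - g ^ Suc M"
      unfolding S_def by (simp add: sum_gp_basic)
    also have "nov_coeff (1 - g ^ Suc M) c = nov_coeff 1 c"
    proof -
      have "nov_coeff (g ^ Suc M) c = 0"
      proof (rule ccontr)
        assume "nov_coeff (g ^ Suc M) c \<noteq> 0"
        then have "real (Suc M) * d \<le> c" by (rule pw)
        moreover have "real (N c) * d < real (Suc M) * d" using d by (auto simp: M_def)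
        ultimately show False using Nx[of c] by linarith
      qed
      then show ?thesis by (simp add: nov_coeff_minus)
    qed
    finally show "nov_coeff ((1 - g) * h) c = nov_coeff 1 c" .
  qed
  then show ?thesis by blast
qed

lemma nov_inverse_exists:
  fixes f :: "'k::field novikov"
  assumes "f \<noteq> 0"
  shows "\<exists>g. f * g = 1"
proof -
  obtain x0 where x0: "nov_coeff f x0 \<noteq> 0"
    using assms novikov_eqI[of f 0] by (auto simp: zero_novikov.rep_eq)
  define S where "S = {x. nov_coeff f x \<noteq> 0 \<and> x \<le> x0}"
  have S: "finite S" "x0 \<in> S" using x0 nov_finite by (auto simp: S_def)
  define v where "v = Min S"
  have "v \<in> S" unfolding v_def using S by (intro Min_in) auto
  then have v: "nov_coeff f v \<noteq> 0" "v \<le> x0" by (auto simp: S_def)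
  have vmin: "v \<le> x" if "nov_coeff f x \<noteq> 0" for x
  proof (cases "x \<le> x0")
    case True
    then show ?thesis using that S unfolding v_def by (intro Min_le) (auto simp: S_def)
  qed (use v in auto)
  define u where "u = nov_monom (inverse (nov_coeff f v)) (- v)"
  define g where "g = 1 - u * f"
  have gc: "nov_coeff g x = (if x = 0 then 0 else - inverse (nov_coeff f v) * nov_coeff f (x + v))" for x
    using v by (auto simp: g_def u_def nov_coeff_minus nov_monom_mult_coeff one_novikov.rep_eq)
  have gpos: "0 < x" if "nov_coeff g x \<noteq> 0" for x
    using that vmin[of "x + v"] by (auto simp: gc split: if_splits)
  define D where "D = insert 1 {x. nov_coeff g x \<noteq> 0 \<and> x \<le> 1}"
  have D: "finite D" "D \<noteq> {}" by (auto simp: D_def nov_finite)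
  have Dpos: "Min D > 0" using D gpos by (auto simp: D_def)
  have "Min D \<le> x" if "nov_coeff g x \<noteq> 0" for x
  proof (cases "x \<le> 1")
    case True
    then show ?thesis using that D by (intro Min_le) (auto simp: D_def)
  next
    case False
    moreover have "Min D \<le> 1" using D by (intro Min_le) (auto simp: D_def)
    ultimately show ?thesis by linarith
  qed
  from nov_geometric[OF Dpos this] obtain h where "(1 - g) * h = 1" by blast
  then have "f * (u * h) = 1" by (simp add: g_def ac_simps)
  then show ?thesis by blast
qed

instantiation novikov :: (field) field
begin

definition inverse_novikov :: "'a novikov \<Rightarrow> 'a novikov" where
  "inverse_novikov f = (if f = 0 then 0 else (SOME g. f * g = 1))"

definition divide_novikov :: "'a novikov \<Rightarrow> 'a novikov \<Rightarrow> 'a novikov" where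
  "divide_novikov f g = f * inverse g"

instance
proof
  fix a b :: "'a novikov"
  show "inverse a * a = 1" if "a \<noteq> 0"
    using someI_ex[OF nov_inverse_exists[OF that]] that
    by (simp add: inverse_novikov_def mult.commute)
  show "a div b = a * inverse b" by (rule divide_novikov_def)
  show "inverse (0 :: 'a novikov) = 0" by (simp add: inverse_novikov_def)
qed

end

lemma nov_coeff_of_nat:
  "nov_coeff (of_nat n :: 'k::comm_ring_1 novikov) x = (if x = 0 then of_nat n else 0)"
  by (induction n) (auto simp: zero_novikov.rep_eq plus_novikov.rep_eq one_novikov.rep_eq)

instance novikov :: (field_char_0) field_char_0
proof
  show "inj (of_nat :: nat \<Rightarrow> 'a novikov)"
    by (rule injI) (metis (full_types) nov_coeff_of_nat of_nat_eq_iff)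
qed

section \<open>Laurent polynomials in several variables\<close>

type_synonym ('n, 'a) laurent_poly = "(int ^ 'n) \<Rightarrow>\<^sub>0 'a"

definition laurent_eval :: "('n::finite, 'a::field) laurent_poly \<Rightarrow> 'a ^ 'n \<Rightarrow> 'a" where
  "laurent_eval p z = (\<Sum>m\<in>Poly_Mapping.keys p. Poly_Mapping.lookup p m * (\<Prod>j\<in>UNIV. (z $ j) powi (m $ j)))"

text \<open>The formal partial derivative, \<open>z\<^sup>m \<mapsto> m\<^sub>j z\<^bsup>m - axis j 1\<^esup>\<close>.\<close>

definition laurent_deriv :: "'n \<Rightarrow> ('n::finite, 'a::field) laurent_poly \<Rightarrow> ('n, 'a) laurent_poly" where
  "laurent_deriv j p =
     (\<Sum>m\<in>Poly_Mapping.keys p.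
        Poly_Mapping.single (m - axis j 1) (of_int (m $ j) * Poly_Mapping.lookup p m))"

definition critical_points :: "('n::finite, 'a::field) laurent_poly \<Rightarrow> ('a ^ 'n) set" where
  "critical_points p = {z. (\<forall>j. z $ j \<noteq> 0) \<and> (\<forall>j. laurent_eval (laurent_deriv j p) z = 0)}"

definition hessian :: "('n::finite, 'a::field) laurent_poly \<Rightarrow> 'a ^ 'n \<Rightarrow> 'a ^ 'n ^ 'n" where
  "hessian p z = (\<chi> i j. laurent_eval (laurent_deriv i (laurent_deriv j p)) z)"

definition morse :: "('n::finite, 'a::field) laurent_poly \<Rightarrow> bool" where
  "morse p \<longleftrightarrow> (\<forall>z\<in>critical_points p. det (hessian p z) \<noteq> 0)"

section \<open>Smooth complete fans and toric symplectic forms\<close>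

definition real_vec :: "int ^ 'n \<Rightarrow> real ^ 'n" where
  "real_vec v = (\<chi> i. real_of_int (v $ i))"

definition rational_polyhedral_cone :: "(real ^ 'n::finite) set \<Rightarrow> bool" where
  "rational_polyhedral_cone \<sigma> \<longleftrightarrow> (\<exists>S :: (int ^ 'n) set. finite S \<and> \<sigma> = convex_cone hull (real_vec ` S))"

definition strongly_convex_cone :: "(real ^ 'n::finite) set \<Rightarrow> bool" where
  "strongly_convex_cone \<sigma> \<longleftrightarrow> (\<forall>v. v \<in> \<sigma> \<and> - v \<in> \<sigma> \<longrightarrow> v = 0)"

text \<open>The library notion of a face includes the empty set, which is not a cone.\<close>

definition is_fan :: "(real ^ 'n::finite) set set \<Rightarrow> bool" where
  "is_fan \<Sigma> \<longleftrightarrow>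
     finite \<Sigma> \<and> \<Sigma> \<noteq> {} \<and>
     (\<forall>\<sigma>\<in>\<Sigma>. rational_polyhedral_cone \<sigma> \<and> strongly_convex_cone \<sigma>) \<and>
     (\<forall>\<sigma>\<in>\<Sigma>. \<forall>\<tau>. \<tau> face_of \<sigma> \<and> \<tau> \<noteq> {} \<longrightarrow> \<tau> \<in> \<Sigma>) \<and>
     (\<forall>\<sigma>\<in>\<Sigma>. \<forall>\<tau>\<in>\<Sigma>. (\<sigma> \<inter> \<tau>) face_of \<sigma> \<and> (\<sigma> \<inter> \<tau>) face_of \<tau>)"

definition complete_fan :: "(real ^ 'n::finite) set set \<Rightarrow> bool" where
  "complete_fan \<Sigma> \<longleftrightarrow> \<Union>\<Sigma> = UNIV"

text \<open>Every cone is generated by part of a basis of the lattice; the bases of the lattice are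
  the families of rows of the integer matrices that are invertible over the integers.\<close>

definition smooth_fan :: "(real ^ 'n::finite) set set \<Rightarrow> bool" where
  "smooth_fan \<Sigma> \<longleftrightarrow>
     (\<forall>\<sigma>\<in>\<Sigma>. \<exists>(B :: int ^ 'n ^ 'n) I.
        invertible B \<and> \<sigma> = convex_cone hull ((\<lambda>i. real_vec (row i B)) ` I))"

definition primitive_vec :: "int ^ 'n::finite \<Rightarrow> bool" where
  "primitive_vec v \<longleftrightarrow> Gcd (range (\<lambda>i. v $ i)) = 1"

text \<open>The edges of a fan are the primitive lattice generators of its one-dimensional cones.\<close>

definition fan_edges :: "(real ^ 'n::finite) set set \<Rightarrow> (int ^ 'n) set" where
  "fan_edges \<Sigma> = {v. primitive_vec v \<and> convex_cone hull {real_vec v} \<in> \<Sigma>}"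

definition piecewise_linear :: "(real ^ 'n::finite) set set \<Rightarrow> (real ^ 'n \<Rightarrow> real) \<Rightarrow> bool" where
  "piecewise_linear \<Sigma> F \<longleftrightarrow> (\<forall>\<sigma>\<in>\<Sigma>. \<exists>u. \<forall>v\<in>\<sigma>. F v = u \<bullet> v)"

text \<open>The inequality is imposed for full-dimensional cones only: these determine \<open>u\<close>, whereas
  for a lower-dimensional cone it cannot hold for all of the many possible choices of \<open>u\<close>.\<close>

definition strictly_convex :: "(real ^ 'n::finite) set set \<Rightarrow> (real ^ 'n \<Rightarrow> real) \<Rightarrow> bool" where
  "strictly_convex \<Sigma> F \<longleftrightarrow>
     (\<forall>\<sigma>\<in>\<Sigma>. dim \<sigma> = CARD('n) \<longrightarrow>
        (\<forall>u. (\<forall>v\<in>\<sigma>. F v = u \<bullet> v) \<longrightarrow> (\<forall>v. v \<notin> \<sigma> \<longrightarrow> u \<bullet> v > F v)))"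

text \<open>The function \<open>F\<close> stands for the toric symplectic form that corresponds to it.\<close>

definition toric_symplectic :: "(real ^ 'n::finite) set set \<Rightarrow> (real ^ 'n \<Rightarrow> real) \<Rightarrow> bool" where
  "toric_symplectic \<Sigma> F \<longleftrightarrow> piecewise_linear \<Sigma> F \<and> strictly_convex \<Sigma> F"

text \<open>The Fano condition: the anticanonical (monotone) class is represented by a toric
  symplectic form, namely the one whose function has value \<open>-1\<close> on all edges.\<close>

definition smooth_fano_fan :: "(real ^ 'n::finite) set set \<Rightarrow> bool" where
  "smooth_fano_fan \<Sigma> \<longleftrightarrow>
     is_fan \<Sigma> \<and> complete_fan \<Sigma> \<and> smooth_fan \<Sigma> \<and>
     (\<exists>F. toric_symplectic \<Sigma> F \<and> (\<forall>v\<in>fan_edges \<Sigma>. F (real_vec v) = -1))"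

text \<open>A toric symplectic form is determined by the values on the edges of its function, so the
  forms are parametrised by a subset of \<open>\<real>\<^sup>r\<close>; near the vector with all entries \<open>-1\<close> one
  finds the small perturbations of the monotone form.\<close>

definition toric_form_values ::
  "(real ^ 'n::finite) set set \<Rightarrow> ('r::finite \<Rightarrow> int ^ 'n) \<Rightarrow> (real ^ 'r) set" where
  "toric_form_values \<Sigma> e =
     {x. \<exists>F. toric_symplectic \<Sigma> F \<and> (\<forall>i. x $ i = F (real_vec (e i)))}"

text \<open>The twisted superpotential: the argument \<open>x\<close> collects the values on the edges, and the
  coefficient field consists of the Laurent series in \<open>T = fls_X\<close> over the series in \<open>s\<close>.\<close>

definition superpotential ::
  "('r::finite \<Rightarrow> int ^ 'n::finite) \<Rightarrow> real ^ 'r \<Rightarrow> ('n, 'k::field novikov fls) laurent_poly" where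
  "superpotential e x =
     (\<Sum>i\<in>UNIV. Poly_Mapping.single (e i) (fls_const (s_powr (- (x $ i))) * fls_X))"

definition generic_on :: "'a::topological_space set \<Rightarrow> ('a \<Rightarrow> bool) \<Rightarrow> bool" where
  "generic_on A P \<longleftrightarrow> (\<exists>U. openin (top_of_set A) U \<and> A \<subseteq> closure U \<and> (\<forall>x\<in>U. P x))"

end

theory Submission
  imports Defs "HOL-Computational_Algebra.Polynomial"
begin

text \<open>
  Write \<open>b\<^sub>i = a\<^sub>i z\<^bsup>e\<^sub>i\<^esup>\<close> for the terms of the superpotential, where \<open>a\<^sub>i = s\<^bsup>-F(e\<^sub>i)\<^esup>\<close>; the factor \<open>T\<close>
  only rescales everything. A point \<open>z\<close> is critical iff \<open>\<Sum>\<^sub>i b\<^sub>i e\<^sub>i = 0\<close>. Suppose that the coefficient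
  field has, for each \<open>k\<close>, a derivation \<open>D\<close> with \<open>D a\<^sub>k = a\<^sub>k\<close> and \<open>D a\<^sub>i = 0\<close> for \<open>i \<noteq> k\<close>, and
  differentiate at a critical point. In the critical value \<open>\<Sum>\<^sub>i b\<^sub>i\<close> the variation of \<open>z\<close> drops out, so
  \<open>D (\<Sum>\<^sub>i b\<^sub>i) = b\<^sub>k\<close>. Hence the critical value is not zero, and it determines all the \<open>b\<^sub>k\<close>, thus the
  monomials \<open>z\<^bsup>e\<^sub>k\<^esup>\<close>, thus \<open>z\<close>, because the edges generate the lattice. The critical equation itself
  gives \<open>b\<^sub>k e\<^sub>k + H (D z / z) = 0\<close> with the logarithmic Hessian \<open>H\<close>, so the image of \<open>H\<close> contains all
  edges and \<open>H\<close> is invertible. These are the lemmas \<open>crit_value_nz\<close>, \<open>crit_value_inj\<close> and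
  \<open>crit_nondeg\<close>.

  Derivations extend along any extension of fields of characteristic zero (\<open>derivation_extends\<close>),
  so the required ones exist as soon as the monomials in the \<open>a\<^sub>i\<close> are linearly independent over the
  integers. For \<open>a\<^sub>i = s\<^bsup>-x\<^sub>i\<^esup>\<close> this means that the real numbers \<open>x\<^sub>i\<close> are linearly independent over the
  rationals, which is a dense condition on \<open>x\<close> but not an open one. Compactness repairs this: if for
  every \<open>k\<close> the conclusion failed at some \<open>x\<close> that avoids all hyperplanes with integer coefficients of
  size at most \<open>k\<close>, then these failures would combine, in an ultrapower of the coefficient field, to
  a failure for coefficients with independent monomials. So avoiding finitely many rational
  hyperplanes is enough (\<open>morse_coeffs_off_hyperplanes\<close>), and this is an open and dense condition.

  Toric geometry contributes two facts. In the fan of a smooth complete variety the edges generate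
  the lattice, because some cone is spanned by a basis (\<open>edges_generate_lattice\<close>). And the values on
  the edges of the strictly convex piecewise linear functions form an open set, so that what is
  left of it off the hyperplanes is still dense in it: a piecewise linear function may be
  prescribed freely on the edges, and its strict convexity amounts to finitely many strict linear
  inequalities between these values (\<open>toric_form_values_eq\<close>).
\<close>

no_notation fps_nth (infixl "$" 75)

section \<open>Extending derivations in characteristic zero\<close>

definition derivation :: "('a::comm_ring_1 \<Rightarrow> 'a) \<Rightarrow> bool" where
  "derivation D \<longleftrightarrow> (\<forall>x y. D (x + y) = D x + D y) \<and> (\<forall>x y. D (x * y) = x * D y + D x * y)"

text \<open>A map \<open>D\<close> is a derivation iff \<open>x \<mapsto> x + D x \<epsilon>\<close> is a homomorphism to the ring of dual numbers,
  where \<open>\<epsilon>\<^sup>2 = 0\<close>. Partially defined derivations thus become subrings of that ring, and extending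
  them means adjoining elements.\<close>

datatype 'a dual = Dual (re: 'a) (eps: 'a)

lemma dual_eqI: "re x = re y \<Longrightarrow> eps x = eps y \<Longrightarrow> x = y"
  by (cases x; cases y) auto

instantiation dual :: (comm_ring_1) comm_ring_1
begin
definition "0 = Dual 0 0"
definition "1 = Dual 1 0"
definition "x + y = Dual (re x + re y) (eps x + eps y)"
definition "x - y = Dual (re x - re y) (eps x - eps y)"
definition "- x = Dual (- re x) (- eps x)"
definition "x * y = Dual (re x * re y) (re x * eps y + eps x * re y)"
instance
  by standard
    (auto simp: zero_dual_def one_dual_def plus_dual_def minus_dual_def uminus_dual_def
      times_dual_def algebra_simps)
end

lemma re_eps_simps [simp]:
  fixes x y :: "'a::comm_ring_1 dual"
  shows "re (0 :: 'a dual) = 0" "eps (0 :: 'a dual) = 0" "re (1 :: 'a dual) = 1" "eps (1 :: 'a dual) = 0"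
    "re (x + y) = re x + re y" "eps (x + y) = eps x + eps y"
    "re (x - y) = re x - re y" "eps (x - y) = eps x - eps y"
    "re (- x) = - re x" "eps (- x) = - eps x"
    "re (x * y) = re x * re y" "eps (x * y) = re x * eps y + eps x * re y"
  by (simp_all add: zero_dual_def one_dual_def plus_dual_def minus_dual_def uminus_dual_def
      times_dual_def)

definition subring :: "'a::comm_ring_1 set \<Rightarrow> bool" where
  "subring R \<longleftrightarrow> 1 \<in> R \<and> (\<forall>x\<in>R. \<forall>y\<in>R. x - y \<in> R \<and> x * y \<in> R)"

lemma subring_closed:
  assumes "subring R"
  shows "0 \<in> R" "1 \<in> R" "\<And>x. x \<in> R \<Longrightarrow> - x \<in> R"
    "\<And>x y. x \<in> R \<Longrightarrow> y \<in> R \<Longrightarrow> x + y \<in> R"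
    "\<And>x y. x \<in> R \<Longrightarrow> y \<in> R \<Longrightarrow> x - y \<in> R"
    "\<And>x y. x \<in> R \<Longrightarrow> y \<in> R \<Longrightarrow> x * y \<in> R"
proof -
  have diff: "x - y \<in> R" and mult: "x * y \<in> R" if "x \<in> R" "y \<in> R" for x y
    using assms that by (auto simp: subring_def)
  have one: "1 \<in> R" using assms by (auto simp: subring_def)
  have zero: "0 \<in> R" using diff[OF one one] by simp
  have uminus: "- x \<in> R" if "x \<in> R" for x using diff[OF zero that] by simp
  have plus: "x + y \<in> R" if "x \<in> R" "y \<in> R" for x y
    using diff[OF that(1) uminus[OF that(2)]] by simp
  show "0 \<in> R" "1 \<in> R" "\<And>x. x \<in> R \<Longrightarrow> - x \<in> R"
    "\<And>x y. x \<in> R \<Longrightarrow> y \<in> R \<Longrightarrow> x + y \<in> R"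
    "\<And>x y. x \<in> R \<Longrightarrow> y \<in> R \<Longrightarrow> x - y \<in> R"
    "\<And>x y. x \<in> R \<Longrightarrow> y \<in> R \<Longrightarrow> x * y \<in> R"
    by (fact zero one uminus plus diff mult)+
qed

lemma subring_power: "subring R \<Longrightarrow> x \<in> R \<Longrightarrow> x ^ n \<in> R"
  by (induction n) (auto intro: subring_closed)

lemma subring_sum: "subring R \<Longrightarrow> (\<And>i. i \<in> A \<Longrightarrow> f i \<in> R) \<Longrightarrow> sum f A \<in> R"
  by (induction A rule: infinite_finite_induct) (auto intro: subring_closed)

lemma subring_of_nat: "subring R \<Longrightarrow> of_nat n \<in> R"
  by (induction n) (auto intro: subring_closed)

definition polys_over :: "'a::comm_ring_1 set \<Rightarrow> 'a poly set" where
  "polys_over R = {p. \<forall>i. coeff p i \<in> R}"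

lemma polys_overD: "p \<in> polys_over R \<Longrightarrow> coeff p i \<in> R"
  by (simp add: polys_over_def)

lemma subring_polys_over:
  assumes "subring R"
  shows "subring (polys_over R)"
  unfolding subring_def polys_over_def
  by (auto simp: coeff_mult intro!: subring_closed[OF assms] subring_sum[OF assms])

lemma subring_adjoin:
  assumes "subring R"
  shows "subring ((\<lambda>p. poly p t) ` polys_over R)"
  unfolding subring_def
proof (intro conjI ballI)
  show "1 \<in> (\<lambda>p. poly p t) ` polys_over R"
    by (rule image_eqI[of _ _ 1]) (auto intro: subring_closed[OF subring_polys_over[OF assms]])
next
  fix x y assume "x \<in> (\<lambda>p. poly p t) ` polys_over R" "y \<in> (\<lambda>p. poly p t) ` polys_over R"
  then obtain p q where pq: "p \<in> polys_over R" "q \<in> polys_over R" "x = poly p t" "y = poly q t" by blast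
  show "x - y \<in> (\<lambda>p. poly p t) ` polys_over R"
    by (rule image_eqI[of _ _ "p - q"]) (auto simp: pq intro: subring_closed[OF subring_polys_over[OF assms]])
  show "x * y \<in> (\<lambda>p. poly p t) ` polys_over R"
    by (rule image_eqI[of _ _ "p * q"]) (auto simp: pq intro: subring_closed[OF subring_polys_over[OF assms]])
qed

lemma const_in_adjoin:
  assumes "subring R" "x \<in> R"
  shows "x \<in> (\<lambda>p. poly p t) ` polys_over R"
  by (rule image_eqI[of _ _ "[:x:]"])
    (use assms subring_closed(1) in \<open>auto simp: polys_over_def coeff_pCons split: nat.splits\<close>)

lemma gen_in_adjoin:
  assumes "subring R"
  shows "t \<in> (\<lambda>p. poly p t) ` polys_over R"
  by (rule image_eqI[of _ _ "[:0, 1:]"])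
    (use assms subring_closed(1,2) in \<open>auto simp: polys_over_def coeff_pCons split: nat.splits\<close>)

text \<open>By additivity, a subring of the dual numbers is the graph of a function iff only \<open>0\<close> lies over \<open>0\<close>;
  the function is then a derivation on the projection of the subring.\<close>

definition derivation_graph :: "'a::comm_ring_1 dual set \<Rightarrow> bool" where
  "derivation_graph G \<longleftrightarrow> subring G \<and> (\<forall>y. Dual 0 y \<in> G \<longrightarrow> y = 0)"

lemma derivation_graph_inj:
  assumes "derivation_graph G" "x \<in> G" "y \<in> G" "re x = re y"
  shows "x = y"
proof -
  have "x - y \<in> G" using assms by (auto simp: derivation_graph_def intro: subring_closed)
  moreover have "x - y = Dual 0 (eps (x - y))" using assms(4) by (auto intro: dual_eqI)
  ultimately have "eps (x - y) = 0" using assms(1) by (metis derivation_graph_def)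
  then show ?thesis using assms(4) by (auto intro: dual_eqI)
qed

lemma re_poly: "re (poly p x) = poly (map_poly re p) (re x)" for p :: "'a::comm_ring_1 dual poly"
  by (induction p) (auto simp: map_poly_pCons)

text \<open>Taylor's formula for dual numbers: all terms of higher order carry the factor \<open>\<epsilon>\<^sup>2\<close>.\<close>

lemma eps_poly:
  fixes p :: "'a::field dual poly"
  shows "eps (poly p (Dual t c)) = eps (poly p (Dual t 0)) + c * poly (pderiv (map_poly re p)) t"
  by (induction p) (auto simp: map_poly_pCons pderiv_pCons re_poly algebra_simps)

lemma derivation_graph_adjoinI:
  assumes "derivation_graph G"
    and "\<And>p. p \<in> polys_over G \<Longrightarrow> re (poly p x) = 0 \<Longrightarrow> eps (poly p x) = 0"
  shows "derivation_graph ((\<lambda>p. poly p x) ` polys_over G)"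
  unfolding derivation_graph_def
proof (intro conjI allI impI)
  show "subring ((\<lambda>p. poly p x) ` polys_over G)"
    using assms(1) by (auto simp: derivation_graph_def intro: subring_adjoin)
  fix y assume "Dual 0 y \<in> (\<lambda>p. poly p x) ` polys_over G"
  then obtain p where p: "p \<in> polys_over G" "poly p x = Dual 0 y" by (metis imageE)
  then show "y = 0" using assms(2)[OF p(1)] by simp
qed

text \<open>Were \<open>t\<close> outside the domain of a maximal graph, then a value \<open>c\<close> for the derivative of \<open>t\<close> could be
  chosen such that adjoining \<open>t + c \<epsilon>\<close> gives a larger graph. This is clear for the inverse of an
  element, which shows that the domain is a field. If \<open>t\<close> is transcendental over the domain,
  every \<open>c\<close> will do. If \<open>t\<close> is algebraic with minimal polynomial \<open>f\<close>, then \<open>c\<close> is forced by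
  \<open>D (f t) = 0\<close>; this equation can be solved because \<open>f' t \<noteq> 0\<close> in characteristic zero.\<close>

lemma maximal_derivation_graph_total:
  fixes G :: "'a::field_char_0 dual set"
  assumes G: "derivation_graph G"
    and max: "\<And>H. derivation_graph H \<Longrightarrow> G \<subseteq> H \<Longrightarrow> H = G"
  shows "re ` G = UNIV"
proof -
  have sub: "subring G" using G by (simp add: derivation_graph_def)
  note cl = subring_closed[OF sub]
  have adjoin: "x \<in> G"
    if "\<And>p. p \<in> polys_over G \<Longrightarrow> re (poly p x) = 0 \<Longrightarrow> eps (poly p x) = 0" for x
  proof -
    have "(\<lambda>p. poly p x) ` polys_over G = G"
      by (rule max[OF derivation_graph_adjoinI[OF G that]]) (auto intro: const_in_adjoin[OF sub])
    then show ?thesis using gen_in_adjoin[OF sub] by blast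
  qed
  define S where "S = re ` G"
  have sub_S: "subring S"
    unfolding subring_def
  proof (intro conjI ballI)
    show "1 \<in> S" unfolding S_def by (rule image_eqI[of _ _ 1]) (auto intro: cl)
    fix x y assume "x \<in> S" "y \<in> S"
    then obtain u v where uv: "u \<in> G" "v \<in> G" "x = re u" "y = re v" by (auto simp: S_def)
    show "x - y \<in> S" unfolding S_def by (rule image_eqI[of _ _ "u - v"]) (auto simp: uv intro: cl)
    show "x * y \<in> S" unfolding S_def by (rule image_eqI[of _ _ "u * v"]) (auto simp: uv intro: cl)
  qed
  have inv_S: "inverse a \<in> S" if "a \<in> S" "a \<noteq> 0" for a
  proof -
    obtain a' where a': "Dual a a' \<in> G" using \<open>a \<in> S\<close> unfolding S_def by (metis dual.collapse imageE)
    let ?g = "Dual a a'" and ?x = "Dual (inverse a) (- (a' / a ^ 2))"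
    have gx: "?g * ?x = 1"
      using \<open>a \<noteq> 0\<close> by (intro dual_eqI) (auto simp: field_simps power2_eq_square)
    \<comment> \<open>Multiplying by a power of \<open>g\<close> clears the powers of its inverse in a polynomial expression,
    which brings the test for a graph back to the given one.\<close>
    have clear: "\<exists>n. ?g ^ n * poly p ?x \<in> G" if "p \<in> polys_over G" for p
      using that
    proof (induction p)
      case 0
      then show ?case by (auto intro: cl)
    next
      case (pCons b p)
      have b: "b \<in> G" using polys_overD[OF pCons.prems, of 0] by simp
      have "p \<in> polys_over G"
        unfolding polys_over_def using polys_overD[OF pCons.prems, of "Suc _"] by simp
      then obtain n where n: "?g ^ n * poly p ?x \<in> G" using pCons.IH by blast
      have "?g ^ Suc n * poly (pCons b p) ?x = ?g ^ Suc n * b + (?g * ?x) * (?g ^ n * poly p ?x)"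
        by (simp add: algebra_simps)
      also have "\<dots> \<in> G" unfolding gx using n b a' by (auto intro!: cl subring_power[OF sub])
      finally show ?case by blast
    qed
    have "?x \<in> G"
    proof (rule adjoin)
      fix p assume p: "p \<in> polys_over G" "re (poly p ?x) = 0"
      obtain n where n: "?g ^ n * poly p ?x \<in> G" using clear[OF p(1)] by blast
      have "re (?g ^ n) = a ^ n" by (induction n) auto
      moreover have "?g ^ n * poly p ?x = 0"
        by (rule derivation_graph_inj[OF G n cl(1)]) (simp add: p)
      then have "eps (?g ^ n * poly p ?x) = 0" by simp
      ultimately show "eps (poly p ?x) = 0" using \<open>a \<noteq> 0\<close> p(2) by simp
    qed
    then show ?thesis unfolding S_def by force
  qed
  have re_zero: "p = 0" if "p \<in> polys_over G" "map_poly re p = 0" for p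
  proof (rule poly_eqI)
    fix i
    have "re (coeff p i) = coeff (map_poly re p) i" by (simp add: coeff_map_poly)
    then show "coeff p i = coeff 0 i"
      using derivation_graph_inj[OF G polys_overD[OF that(1)] cl(1)] that(2) by simp
  qed
  have re_over: "map_poly re p \<in> polys_over S" if "p \<in> polys_over G" for p
    using that by (auto simp: polys_over_def S_def coeff_map_poly)
  have "t \<in> S" for t
  proof -
    define Z where "Z = {f. f \<in> polys_over S \<and> f \<noteq> 0 \<and> poly f t = 0}"
    have "\<exists>c. \<forall>p. p \<in> polys_over G \<longrightarrow> re (poly p (Dual t c)) = 0 \<longrightarrow> eps (poly p (Dual t c)) = 0"
    proof (cases "Z = {}")
      case True
      have "p = 0" if "p \<in> polys_over G" "re (poly p (Dual t 0)) = 0" for p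
      proof (rule re_zero[OF that(1)])
        show "map_poly re p = 0"
          using True re_over[OF that(1)] that(2) unfolding Z_def by (auto simp: re_poly)
      qed
      then have "eps (poly p (Dual t 0)) = 0" if "p \<in> polys_over G" "re (poly p (Dual t 0)) = 0" for p
        using that by (metis poly_0 re_eps_simps(2))
      then show ?thesis by blast
    next
      case False
      then obtain g0 where "g0 \<in> Z" by blast
      then have "\<exists>f0. f0 \<in> Z \<and> (\<forall>g. g \<in> Z \<longrightarrow> degree f0 \<le> degree g)"
        by (rule ex_has_least_nat)
      then obtain f0 where f0: "f0 \<in> Z" and min0: "\<And>g. g \<in> Z \<Longrightarrow> degree f0 \<le> degree g" by blast
      define f where "f = smult (inverse (lead_coeff f0)) f0"
      have "lead_coeff f0 \<in> S" "lead_coeff f0 \<noteq> 0" using f0 by (auto simp: Z_def polys_over_def)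
      note lc = inv_S[OF this] this(2)
      have fZ: "f \<in> Z" and monic: "lead_coeff f = 1" and degf: "degree f = degree f0"
        using f0 lc by (auto simp: Z_def f_def polys_over_def intro: subring_closed[OF sub_S])
      have min: "h = 0" if "h \<in> polys_over S" "poly h t = 0" "degree h < degree f" for h
        using min0[of h] that degf by (auto simp: Z_def)
      have "degree f \<noteq> 0"
      proof
        assume "degree f = 0"
        then obtain b where "f = [:b:]" by (rule degree_eq_zeroE)
        then show False using fZ by (simp add: Z_def)
      qed
      then have pd: "poly (pderiv f) t \<noteq> 0"
      proof -
        have "pderiv f \<in> polys_over S"
          using fZ by (auto simp: Z_def polys_over_def coeff_pderiv
              intro!: subring_closed[OF sub_S] subring_of_nat[OF sub_S] simp del: of_nat_Suc)
        moreover have "pderiv f \<noteq> 0" "degree (pderiv f) < degree f"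
          using \<open>degree f \<noteq> 0\<close> by (auto simp: pderiv_eq_0_iff degree_pderiv)
        ultimately show ?thesis using min by blast
      qed
      \<comment> \<open>Lift \<open>f\<close> to the graph by adding to each coefficient its derivative.\<close>
      define L where "L s = (if s = 0 then 0 else SOME x. x \<in> G \<and> re x = s)" for s
      have L: "L s \<in> G \<and> re (L s) = s" if "s \<in> S" for s
      proof (cases "s = 0")
        case False
        then show ?thesis using someI_ex[of "\<lambda>x. x \<in> G \<and> re x = s"] that by (auto simp: L_def S_def)
      qed (auto simp: L_def cl)
      define F where "F = map_poly L f"
      have cF: "coeff F i = L (coeff f i)" for i by (simp add: F_def coeff_map_poly L_def)
      have F: "F \<in> polys_over G" "map_poly re F = f"
        using L fZ by (auto simp: polys_over_def cF Z_def coeff_map_poly intro!: poly_eqI)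
      have "coeff F (degree f) = 1"
        by (rule derivation_graph_inj[OF G _ cl(2)])
          (use L[OF subring_closed(2)[OF sub_S]] monic in \<open>auto simp: cF\<close>)
      define c where "c = - eps (poly F (Dual t 0)) / poly (pderiv f) t"
      have F0: "poly F (Dual t c) = 0"
      proof (rule dual_eqI)
        show "re (poly F (Dual t c)) = re 0" using fZ by (simp add: re_poly F Z_def)
        show "eps (poly F (Dual t c)) = eps 0"
          unfolding eps_poly[of F t c] F using pd by (simp add: c_def)
      qed
      \<comment> \<open>Division with remainder by the monic \<open>F\<close>, as an induction on a degree bound \<open>n\<close>: a remainder
      that vanishes at \<open>t\<close> is zero by the minimality of \<open>f\<close>.\<close>
      have vanish: "poly p (Dual t c) = 0"
        if "p \<in> polys_over G" "re (poly p (Dual t c)) = 0" "\<forall>i\<ge>n. coeff p i = 0" for p n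
        using that
      proof (induction n arbitrary: p)
        case 0
        then have "p = 0" by (intro poly_eqI) auto
        then show ?case by simp
      next
        case (Suc n)
        show ?case
        proof (cases "n < degree f")
          case True
          have "map_poly re p = 0"
          proof (rule min)
            show "poly (map_poly re p) t = 0" using Suc.prems(2) by (simp add: re_poly)
            have "degree (map_poly re p) \<le> n"
              using Suc.prems(3) by (intro degree_le) (auto simp: coeff_map_poly)
            then show "degree (map_poly re p) < degree f" using True by simp
          qed (rule re_over[OF Suc.prems(1)])
          then show ?thesis using re_zero[OF Suc.prems(1)] by simp
        next
          case False
          define q where "q = p - monom (coeff p n) (n - degree f) * F"
          have "poly q (Dual t c) = 0"
          proof (rule Suc.IH)
            have "monom (coeff p n) (n - degree f) \<in> polys_over G"
              using polys_overD[OF Suc.prems(1)] cl(1) by (auto simp: polys_over_def)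
            then show "q \<in> polys_over G"
              unfolding q_def using F Suc.prems(1) subring_closed(5,6)[OF subring_polys_over[OF sub]]
              by blast
            show "re (poly q (Dual t c)) = 0" using Suc.prems(2) by (simp add: q_def F0)
            show "\<forall>i\<ge>n. coeff q i = 0"
            proof (intro allI impI)
              fix i assume i: "n \<le> i"
              show "coeff q i = 0"
              proof (cases "i = n")
                case True
                then show ?thesis
                  using False \<open>coeff F (degree f) = 1\<close> by (simp add: q_def coeff_monom_mult)
              next
                case ni: False
                have "coeff F (i - (n - degree f)) = 0"
                  using i ni False by (auto simp: cF coeff_eq_0 L_def)
                then show ?thesis
                  using i ni Suc.prems(3) by (simp add: q_def coeff_monom_mult)
              qed
            qed
          qed
          then show ?thesis by (simp add: q_def F0)
        qed
      qed
      have "eps (poly p (Dual t c)) = 0"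
        if "p \<in> polys_over G" "re (poly p (Dual t c)) = 0" for p
        using vanish[OF that, of "Suc (degree p)"] by (simp add: coeff_eq_0)
      then show ?thesis by blast
    qed
    then obtain c where "Dual t c \<in> G" using adjoin by blast
    then show ?thesis unfolding S_def by force
  qed
  then show ?thesis by (auto simp: S_def)
qed

lemma derivation_extends:
  fixes G0 :: "'a::field_char_0 dual set"
  assumes "derivation_graph G0"
  shows "\<exists>D. derivation D \<and> (\<forall>x\<in>G0. D (re x) = eps x)"
proof -
  define A where "A = {G. derivation_graph G \<and> G0 \<subseteq> G}"
  have "\<exists>G\<in>A. \<forall>H\<in>A. G \<subseteq> H \<longrightarrow> H = G"
  proof (rule subset_Zorn_nonempty)
    show "A \<noteq> {}" using assms by (auto simp: A_def)
    fix C assume C: "C \<noteq> {}" "subset.chain A C"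
    have CA: "C \<subseteq> A" using C(2) by (auto simp: subset.chain_def)
    have graph: "subring G" "\<And>y. Dual 0 y \<in> G \<Longrightarrow> y = 0" "G0 \<subseteq> G" if "G \<in> C" for G
      using that CA by (auto simp: A_def derivation_graph_def)
    obtain G1 where G1: "G1 \<in> C" using C(1) by blast
    have "subring (\<Union>C)"
      unfolding subring_def
    proof (intro conjI ballI)
      show "1 \<in> \<Union>C" using G1 subring_closed(2)[OF graph(1)[OF G1]] by blast
      fix x y assume "x \<in> \<Union>C" "y \<in> \<Union>C"
      then obtain G H where GH: "G \<in> C" "x \<in> G" "H \<in> C" "y \<in> H" by blast
      then have "G \<subseteq> H \<or> H \<subseteq> G" using C(2) by (auto simp: subset.chain_def)
      then obtain K where K: "K \<in> C" "x \<in> K" "y \<in> K" using GH by blast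
      show "x - y \<in> \<Union>C" "x * y \<in> \<Union>C"
        using subring_closed(5,6)[OF graph(1)[OF K(1)] K(2,3)] K(1) by blast+
    qed
    moreover have "y = 0" if "Dual 0 y \<in> \<Union>C" for y using that graph(2) by blast
    moreover have "G0 \<subseteq> \<Union>C" using graph(3)[OF G1] G1 by blast
    ultimately show "\<Union>C \<in> A" by (simp add: A_def derivation_graph_def)
  qed
  then obtain G where GA: "G \<in> A" and maxA: "\<forall>H\<in>A. G \<subseteq> H \<longrightarrow> H = G" by blast
  have G: "derivation_graph G" "G0 \<subseteq> G" using GA by (auto simp: A_def)
  have max: "H = G" if "derivation_graph H" "G \<subseteq> H" for H
    using maxA that G(2) by (simp add: A_def)
  have "re ` G = UNIV" by (rule maximal_derivation_graph_total[OF G(1) max])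
  then have "\<forall>s. \<exists>x. x \<in> G \<and> re x = s" by (metis UNIV_I imageE)
  then obtain L where L: "\<And>s. L s \<in> G" "\<And>s. re (L s) = s" by metis
  have sub: "subring G" using G by (simp add: derivation_graph_def)
  have LI: "L s = x" if "x \<in> G" "re x = s" for x s
    by (rule derivation_graph_inj[OF G(1)]) (use L that in auto)
  have "L (x + y) = L x + L y" "L (x * y) = L x * L y" for x y
    using L subring_closed[OF sub] by (auto intro!: LI)
  then have "derivation (\<lambda>s. eps (L s))"
    using L by (auto simp: derivation_def)
  moreover have "\<forall>x\<in>G0. eps (L (re x)) = eps x" using LI G(2) by auto
  ultimately show ?thesis by blast
qed

section \<open>Critical points over a field with enough derivations\<close>

definition laurent_monomial :: "'a::field ^ 'n::finite \<Rightarrow> int ^ 'n \<Rightarrow> 'a" where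
  "laurent_monomial z m = (\<Prod>j\<in>UNIV. (z $ j) powi (m $ j))"

lemma laurent_monomial_nz: "(\<And>j. z $ j \<noteq> 0) \<Longrightarrow> laurent_monomial z m \<noteq> 0"
  by (simp add: laurent_monomial_def)

lemma laurent_monomial_0 [simp]: "laurent_monomial z 0 = 1"
  by (simp add: laurent_monomial_def)

lemma laurent_monomial_add: "(\<And>j. z $ j \<noteq> 0) \<Longrightarrow> laurent_monomial z (m + m') = laurent_monomial z m * laurent_monomial z m'"
  by (simp add: laurent_monomial_def power_int_add prod.distrib)

lemma laurent_monomial_axis: "laurent_monomial z (axis j 1) = z $ j"
  by (simp add: laurent_monomial_def axis_def if_distrib[of "(powi) _"] prod.If_cases if_distrib cong: if_cong)

lemma prod_power_int: "(\<Prod>i\<in>A. f i) powi n = (\<Prod>i\<in>A. f i powi n)" for f :: "'b \<Rightarrow> 'a::field"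
  by (induction A rule: infinite_finite_induct) (auto simp: power_int_mult_distrib)

lemma prod_powi_sum:
  assumes "x \<noteq> (0::'a::field)"
  shows "(\<Prod>i\<in>A. x powi (f i)) = x powi (\<Sum>i\<in>A. f i)"
  using assms by (induction A rule: infinite_finite_induct) (auto simp: power_int_add)

text \<open>The matrix \<open>C\<close> writes the unit vectors as integer combinations of the \<open>e i\<close>, so the coordinates of a
  point of the torus are monomials in the values \<open>z\<^bsup>e i\<^esup>\<close>.\<close>

lemma laurent_monomial_basis:
  fixes e :: "'r::finite \<Rightarrow> int ^ 'n::finite"
  assumes C: "\<And>j l. (\<Sum>i\<in>UNIV. C j i * e i $ l) = (if j = l then 1 else 0)"
    and z: "\<And>j. z $ j \<noteq> 0"
  shows "z $ j = (\<Prod>i\<in>UNIV. laurent_monomial z (e i) powi C j i)"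
proof -
  have "(\<Prod>i\<in>UNIV. laurent_monomial z (e i) powi C j i) = (\<Prod>i\<in>UNIV. \<Prod>l\<in>UNIV. (z $ l) powi (C j i * e i $ l))"
    by (simp add: laurent_monomial_def prod_power_int) (simp add: mult.commute flip: power_int_mult)
  also have "\<dots> = (\<Prod>l\<in>UNIV. \<Prod>i\<in>UNIV. (z $ l) powi (C j i * e i $ l))"
    by (rule prod.swap)
  also have "\<dots> = (\<Prod>l\<in>UNIV. (z $ l) powi (if j = l then 1 else 0))"
    using z by (simp add: prod_powi_sum C)
  also have "\<dots> = (\<Prod>l\<in>UNIV. if j = l then z $ l else 1)"
    by (intro prod.cong) auto
  also have "\<dots> = z $ j" by simp
  finally show ?thesis ..
qed

lemma
  assumes "derivation D"
  shows derivation_add: "D (x + y) = D x + D y"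
    and derivation_mult: "D (x * y) = x * D y + D x * y"
    and derivation_0: "D 0 = 0"
    and derivation_1: "D 1 = 0"
    and derivation_minus: "D (- x) = - D x"
    and derivation_sum: "D (sum f A) = (\<Sum>i\<in>A. D (f i))"
proof -
  show add: "D (x + y) = D x + D y" for x y using assms by (simp add: derivation_def)
  show mult: "D (x * y) = x * D y + D x * y" for x y using assms by (simp add: derivation_def)
  show zero: "D 0 = 0" using add[of 0 0] by simp
  show one: "D 1 = 0" using mult[of 1 1] by simp
  show "D (- x) = - D x" using add[of x "- x"] zero by (simp add: eq_neg_iff_add_eq_0 add.commute)
  show "D (sum f A) = (\<Sum>i\<in>A. D (f i))"
    by (induction A rule: infinite_finite_induct) (auto simp: zero add)
qed

lemma derivation_of_int:
  assumes "derivation D"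
  shows "D (of_int n) = 0"
proof -
  have "D (of_nat k) = 0" for k
    by (induction k) (auto simp: derivation_0[OF assms] derivation_1[OF assms] derivation_add[OF assms])
  then show ?thesis
    by (cases n rule: int_cases2) (auto simp: derivation_minus[OF assms])
qed

lemma derivation_of_int_mult:
  assumes "derivation D"
  shows "D (of_int n * x) = of_int n * D x"
  by (simp add: derivation_mult[OF assms] derivation_of_int[OF assms])

definition dlog :: "('a::field \<Rightarrow> 'a) \<Rightarrow> 'a \<Rightarrow> 'a" where
  "dlog D x = D x / x"

lemma dlog_mult:
  assumes "derivation D" "x \<noteq> 0" "y \<noteq> 0"
  shows "dlog D (x * y) = dlog D x + dlog D y"
  using assms by (simp add: dlog_def derivation_mult field_simps)

lemma dlog_1: "derivation D \<Longrightarrow> dlog D 1 = 0"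
  by (simp add: dlog_def derivation_1)

lemma dlog_prod:
  assumes "derivation D" "\<And>i. i \<in> A \<Longrightarrow> f i \<noteq> 0"
  shows "dlog D (prod f A) = (\<Sum>i\<in>A. dlog D (f i))"
  using assms(2) by (induction A rule: infinite_finite_induct) (auto simp: dlog_mult[OF assms(1)] dlog_1[OF assms(1)])

lemma dlog_inverse:
  assumes "derivation D" "x \<noteq> 0"
  shows "dlog D (inverse x) = - dlog D x"
  using dlog_mult[OF assms(1), of x "inverse x"] assms(2) dlog_1[OF assms(1)]
  by (simp add: eq_neg_iff_add_eq_0 add.commute)

lemma dlog_powi:
  assumes "derivation D" "x \<noteq> 0"
  shows "dlog D (x powi n) = of_int n * dlog D x"
proof -
  have nat: "dlog D (x ^ k) = of_nat k * dlog D x" for k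
    by (induction k) (use assms in \<open>auto simp: dlog_mult dlog_1 algebra_simps\<close>)
  show ?thesis
    by (cases n rule: int_cases2)
      (use assms in \<open>auto simp: power_int_minus dlog_inverse nat\<close>)
qed

lemma dlog_laurent_monomial:
  assumes "derivation D" "\<And>j. z $ j \<noteq> 0"
  shows "dlog D (laurent_monomial z m) = (\<Sum>j\<in>UNIV. of_int (m $ j) * dlog D (z $ j))"
  unfolding laurent_monomial_def using assms by (simp add: dlog_prod dlog_powi)

text \<open>The critical equations of \<open>\<Sum>\<^sub>i a\<^sub>i z\<^bsup>e\<^sub>i\<^esup>\<close> for the logarithmic derivatives \<open>z\<^sub>j \<partial>/\<partial>z\<^sub>j\<close>, in which all
  exponents are still the \<open>e\<^sub>i\<close>; likewise for the value and the Hessian below.\<close>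

definition log_critical :: "('r::finite \<Rightarrow> int ^ 'n::finite) \<Rightarrow> 'a::field ^ 'r \<Rightarrow> 'a ^ 'n \<Rightarrow> bool" where
  "log_critical e a z \<longleftrightarrow> (\<forall>j. z $ j \<noteq> 0) \<and>
     (\<forall>j. (\<Sum>i\<in>UNIV. of_int (e i $ j) * (a $ i * laurent_monomial z (e i))) = 0)"

definition log_value :: "('r::finite \<Rightarrow> int ^ 'n::finite) \<Rightarrow> 'a::field ^ 'r \<Rightarrow> 'a ^ 'n \<Rightarrow> 'a" where
  "log_value e a z = (\<Sum>i\<in>UNIV. a $ i * laurent_monomial z (e i))"

definition log_hessian :: "('r::finite \<Rightarrow> int ^ 'n::finite) \<Rightarrow> 'a::field ^ 'r \<Rightarrow> 'a ^ 'n \<Rightarrow> 'a ^ 'n ^ 'n" where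
  "log_hessian e a z = (\<chi> j l. \<Sum>i\<in>UNIV. of_int (e i $ j) * of_int (e i $ l) * (a $ i * laurent_monomial z (e i)))"

text \<open>Nondegeneracy is expressed by kernel vectors because these pass to an ultrapower coordinate
  by coordinate.\<close>

definition morse_coeffs :: "('r::finite \<Rightarrow> int ^ 'n::finite) \<Rightarrow> 'a::field ^ 'r \<Rightarrow> bool" where
  "morse_coeffs e a \<longleftrightarrow> (\<forall>z. log_critical e a z \<longrightarrow> log_value e a z \<noteq> 0 \<and>
     (\<forall>w. log_critical e a w \<longrightarrow> log_value e a z = log_value e a w \<longrightarrow> z = w) \<and>
     (\<forall>y. y v* log_hessian e a z = 0 \<longrightarrow> y = 0))"

text \<open>\<open>D k\<close> plays the role of \<open>a\<^sub>k \<partial>/\<partial>a\<^sub>k\<close>, and \<open>C\<close> certifies that the \<open>e i\<close> generate the lattice.\<close>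

locale toric_derivations =
  fixes e :: "'r::finite \<Rightarrow> int ^ 'n::finite" and C :: "'n \<Rightarrow> 'r \<Rightarrow> int"
    and a :: "'a::field_char_0 ^ 'r" and D :: "'r \<Rightarrow> 'a \<Rightarrow> 'a"
  assumes C: "\<And>j l. (\<Sum>i\<in>UNIV. C j i * e i $ l) = (if j = l then 1 else 0)"
    and a: "\<And>i. a $ i \<noteq> 0"
    and D: "\<And>i. derivation (D i)" "\<And>i k. D i (a $ k) = (if k = i then a $ k else 0)"
begin

lemma D_term:
  assumes z: "\<And>j. z $ j \<noteq> 0"
  shows "D k (a $ i * laurent_monomial z (e i)) =
    a $ i * laurent_monomial z (e i) * ((if i = k then 1 else 0) + (\<Sum>j\<in>UNIV. of_int (e i $ j) * dlog (D k) (z $ j)))"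
proof -
  have "a $ i * laurent_monomial z (e i) \<noteq> 0" using a laurent_monomial_nz[OF z] by simp
  then have "D k (a $ i * laurent_monomial z (e i)) = a $ i * laurent_monomial z (e i) * dlog (D k) (a $ i * laurent_monomial z (e i))"
    by (simp add: dlog_def)
  also have "dlog (D k) (a $ i * laurent_monomial z (e i)) =
      (if i = k then 1 else 0) + (\<Sum>j\<in>UNIV. of_int (e i $ j) * dlog (D k) (z $ j))"
    using a laurent_monomial_nz[OF z] z D by (simp add: dlog_mult dlog_laurent_monomial) (simp add: dlog_def)
  finally show ?thesis .
qed

text \<open>The variation of \<open>z\<close> enters through a combination of the critical equations, with the logarithmic
  derivatives of the coordinates as factors; only the explicit dependence on \<open>a\<^sub>k\<close> is left.\<close>

lemma D_crit_value:
  assumes z: "log_critical e a z"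
  shows "D k (log_value e a z) = a $ k * laurent_monomial z (e k)"
proof -
  have nz: "z $ j \<noteq> 0" for j using z by (simp add: log_critical_def)
  define b where "b i = a $ i * laurent_monomial z (e i)" for i
  have "D k (\<Sum>i\<in>UNIV. b i) = (\<Sum>i\<in>UNIV. b i * (if i = k then 1 else 0))
      + (\<Sum>i\<in>UNIV. \<Sum>j\<in>UNIV. dlog (D k) (z $ j) * (of_int (e i $ j) * b i))"
    unfolding derivation_sum[OF D(1)] b_def D_term[OF nz]
    by (simp add: distrib_left sum.distrib sum_distrib_left algebra_simps)
  also have "(\<Sum>i\<in>UNIV. \<Sum>j\<in>UNIV. dlog (D k) (z $ j) * (of_int (e i $ j) * b i))
      = (\<Sum>j\<in>UNIV. dlog (D k) (z $ j) * (\<Sum>i\<in>UNIV. of_int (e i $ j) * b i))"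
    by (subst sum.swap) (simp add: sum_distrib_left)
  also have "\<dots> = 0" using z by (simp add: log_critical_def b_def)
  finally show ?thesis by (simp add: log_value_def b_def if_distrib[of "(*) _"] cong: if_cong)
qed

lemma crit_value_nz:
  assumes "log_critical e a z"
  shows "log_value e a z \<noteq> 0"
proof
  assume "log_value e a z = 0"
  then have "a $ k * laurent_monomial z (e k) = 0" for k
    using D_crit_value[OF assms, of k] by (simp add: derivation_0[OF D(1)])
  moreover have "laurent_monomial z m \<noteq> 0" for m using assms by (intro laurent_monomial_nz) (simp add: log_critical_def)
  ultimately show False using a by simp
qed

lemma crit_value_inj:
  assumes z: "log_critical e a z" and w: "log_critical e a w"
    and eq: "log_value e a z = log_value e a w"
  shows "z = w"
proof -
  have "laurent_monomial z (e k) = laurent_monomial w (e k)" for k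
    using D_crit_value[OF z, of k] D_crit_value[OF w, of k] a[of k] by (simp add: eq)
  moreover have "z $ j = (\<Prod>i\<in>UNIV. laurent_monomial z (e i) powi C j i)"
    "w $ j = (\<Prod>i\<in>UNIV. laurent_monomial w (e i) powi C j i)" for j
    by (rule laurent_monomial_basis[OF C]; use z w in \<open>simp add: log_critical_def\<close>)+
  ultimately show ?thesis by (simp add: vec_eq_iff)
qed

text \<open>Applying \<open>D k\<close> to the critical equations shows that \<open>b\<^sub>k e\<^sub>k\<close> lies in the image of the logarithmic
  Hessian, so a vector in its left kernel is orthogonal to all \<open>e\<^sub>k\<close>.\<close>

lemma crit_nondeg:
  assumes z: "log_critical e a z"
    and y: "y v* log_hessian e a z = 0"
  shows "y = 0"
proof -
  have nz: "z $ j \<noteq> 0" for j using z by (simp add: log_critical_def)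
  define b where "b i = a $ i * laurent_monomial z (e i)" for i
  have b: "b i \<noteq> 0" for i using a laurent_monomial_nz[OF nz] by (simp add: b_def)
  define H where "H j l = (\<Sum>i\<in>UNIV. of_int (e i $ j) * of_int (e i $ l) * b i)" for j l
  have y': "(\<Sum>j\<in>UNIV. y $ j * H j l) = 0" for l
  proof -
    have "(\<Sum>j\<in>UNIV. y $ j * H j l) = (y v* log_hessian e a z) $ l"
      by (simp add: vector_matrix_mult_def log_hessian_def H_def b_def mult.commute[of "y $ j" for j])
    then show ?thesis by (simp add: y)
  qed
  have 1: "of_int (e k $ j) * b k = - (\<Sum>l\<in>UNIV. H j l * dlog (D k) (z $ l))" for j k
  proof -
    have "0 = D k (\<Sum>i\<in>UNIV. of_int (e i $ j) * b i)"
      using z by (simp add: log_critical_def b_def derivation_0[OF D(1)])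
    also have "\<dots> = (\<Sum>i\<in>UNIV. of_int (e i $ j) *
        (b i * ((if i = k then 1 else 0) + (\<Sum>l\<in>UNIV. of_int (e i $ l) * dlog (D k) (z $ l)))))"
      by (simp add: derivation_sum[OF D(1)] derivation_of_int_mult[OF D(1)] b_def D_term[OF nz])
    also have "\<dots> = (\<Sum>i\<in>UNIV. of_int (e i $ j) * b i * (if i = k then 1 else 0)) +
        (\<Sum>i\<in>UNIV. \<Sum>l\<in>UNIV. of_int (e i $ j) * of_int (e i $ l) * b i * dlog (D k) (z $ l))"
      by (simp add: distrib_left sum.distrib sum_distrib_left algebra_simps)
    also have "(\<Sum>i\<in>UNIV. \<Sum>l\<in>UNIV. of_int (e i $ j) * of_int (e i $ l) * b i * dlog (D k) (z $ l))
        = (\<Sum>l\<in>UNIV. H j l * dlog (D k) (z $ l))"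
      by (subst sum.swap) (simp add: H_def sum_distrib_right)
    finally show ?thesis
      by (simp add: eq_neg_iff_add_eq_0 if_distrib[of "(*) _"] cong: if_cong)
  qed
  have ye: "(\<Sum>j\<in>UNIV. y $ j * of_int (e k $ j)) = 0" for k
  proof -
    have "(\<Sum>j\<in>UNIV. y $ j * of_int (e k $ j)) * b k = (\<Sum>j\<in>UNIV. y $ j * (of_int (e k $ j) * b k))"
      by (simp add: sum_distrib_right mult.assoc)
    also have "\<dots> = - (\<Sum>j\<in>UNIV. \<Sum>l\<in>UNIV. y $ j * H j l * dlog (D k) (z $ l))"
      by (simp add: 1 sum_distrib_left sum_negf mult.assoc)
    also have "\<dots> = - (\<Sum>l\<in>UNIV. (\<Sum>j\<in>UNIV. y $ j * H j l) * dlog (D k) (z $ l))"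
      by (subst sum.swap) (simp add: sum_distrib_right)
    also have "\<dots> = 0" using y' by simp
    finally show ?thesis using b by simp
  qed
  have "y $ l = 0" for l
  proof -
    have "(\<Sum>j\<in>UNIV. y $ j * of_int (\<Sum>k\<in>UNIV. C l k * e k $ j)) = (\<Sum>k\<in>UNIV. of_int (C l k) * (\<Sum>j\<in>UNIV. y $ j * of_int (e k $ j)))"
      by (simp add: sum_distrib_left) (subst sum.swap, simp add: mult_ac)
    then have "(\<Sum>j\<in>UNIV. y $ j * of_int (if l = j then 1 else 0)) = 0"
      by (simp only: ye C) simp
    then show ?thesis by (simp add: if_distrib cong: if_cong)
  qed
  then show ?thesis by (simp add: vec_eq_iff)
qed

lemma coeffs_morse: "morse_coeffs e a"
  unfolding morse_coeffs_def using crit_value_nz crit_value_inj crit_nondeg by blast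

end

section \<open>Derivations from multiplicatively generic coefficients\<close>

text \<open>The graph of \<open>a\<^sub>k \<partial>/\<partial>a\<^sub>k\<close> on the ring generated by the Laurent monomials in \<open>a\<close>. Independence of
  the monomials makes it single-valued. Differences are enough to generate the ring, because products
  of monomials are monomials.\<close>

inductive_set monomial_graph :: "'a::field ^ 'r::finite \<Rightarrow> 'r \<Rightarrow> 'a dual set"
  for a :: "'a ^ 'r" and k :: 'r where
  char: "Dual (laurent_monomial a m) (of_int (m $ k) * laurent_monomial a m) \<in> monomial_graph a k"
| diff: "x \<in> monomial_graph a k \<Longrightarrow> y \<in> monomial_graph a k \<Longrightarrow> x - y \<in> monomial_graph a k"

lemma monomial_graph_mult:
  assumes a: "\<And>i. a $ i \<noteq> 0" and "x \<in> monomial_graph a k" "y \<in> monomial_graph a k"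
  shows "x * y \<in> monomial_graph a k"
  using assms(2)
proof induction
  case (char m)
  show ?case using assms(3)
  proof induction
    case (char m')
    have "Dual (laurent_monomial a m) (of_int (m $ k) * laurent_monomial a m) * Dual (laurent_monomial a m') (of_int (m' $ k) * laurent_monomial a m')
       = Dual (laurent_monomial a (m + m')) (of_int ((m + m') $ k) * laurent_monomial a (m + m'))"
      by (rule dual_eqI) (auto simp: laurent_monomial_add[OF a] algebra_simps)
    then show ?case by (simp only: monomial_graph.char)
  next
    case (diff x y)
    then show ?case by (simp add: right_diff_distrib monomial_graph.diff)
  qed
next
  case (diff x y)
  then show ?case by (simp add: left_diff_distrib monomial_graph.diff)
qed

lemma monomial_graph_repr:
  assumes "x \<in> monomial_graph a k"
  shows "\<exists>F c. finite F \<and> (\<forall>m. m \<notin> F \<longrightarrow> c m = (0::int)) \<and>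
    re x = (\<Sum>m\<in>F. of_int (c m) * laurent_monomial a m) \<and>
    eps x = (\<Sum>m\<in>F. of_int (c m) * (of_int (m $ k) * laurent_monomial a m))"
  using assms
proof induction
  case (char m)
  show ?case by (rule exI[of _ "{m}"], rule exI[of _ "\<lambda>m'. if m' = m then 1 else 0"]) auto
next
  case (diff x y)
  obtain F c where F: "finite F" "\<forall>m. m \<notin> F \<longrightarrow> c m = (0::int)"
      "re x = (\<Sum>m\<in>F. of_int (c m) * laurent_monomial a m)"
      "eps x = (\<Sum>m\<in>F. of_int (c m) * (of_int (m $ k) * laurent_monomial a m))"
    using diff.IH(1) by blast
  obtain F' c' where F': "finite F'" "\<forall>m. m \<notin> F' \<longrightarrow> c' m = (0::int)"
      "re y = (\<Sum>m\<in>F'. of_int (c' m) * laurent_monomial a m)"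
      "eps y = (\<Sum>m\<in>F'. of_int (c' m) * (of_int (m $ k) * laurent_monomial a m))"
    using diff.IH(2) by blast
  have sums: "(\<Sum>m\<in>F. of_int (c m) * g m) - (\<Sum>m\<in>F'. of_int (c' m) * g m) =
      (\<Sum>m\<in>F \<union> F'. of_int (c m - c' m) * g m)" for g :: "int ^ 'b \<Rightarrow> 'a"
  proof -
    have "(\<Sum>m\<in>F. of_int (c m) * g m) = (\<Sum>m\<in>F \<union> F'. of_int (c m) * g m)"
      by (rule sum.mono_neutral_left) (use F F' in auto)
    moreover have "(\<Sum>m\<in>F'. of_int (c' m) * g m) = (\<Sum>m\<in>F \<union> F'. of_int (c' m) * g m)"
      by (rule sum.mono_neutral_left) (use F F' in auto)
    ultimately show ?thesis by (simp add: sum_subtractf left_diff_distrib)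
  qed
  show ?case
    by (rule exI[of _ "F \<union> F'"], rule exI[of _ "\<lambda>m. c m - c' m"]) (use F F' in \<open>simp add: sums\<close>)
qed

lemma derivations_of_independent:
  fixes a :: "'a::field_char_0 ^ 'r::finite"
  assumes a: "\<And>i. a $ i \<noteq> 0"
    and indep: "\<And>F c. finite F \<Longrightarrow> (\<Sum>m\<in>F. of_int (c m) * laurent_monomial a m) = 0 \<Longrightarrow> \<forall>m\<in>F. c m = (0::int)"
  shows "\<exists>D. derivation D \<and> (\<forall>i. D (a $ i) = (if i = k then a $ i else 0))"
proof -
  have "derivation_graph (monomial_graph a k)"
    unfolding derivation_graph_def subring_def
  proof (intro conjI ballI allI impI)
    have "Dual (laurent_monomial a 0) (of_int (0 $ k) * laurent_monomial a 0) \<in> monomial_graph a k" by (rule monomial_graph.char)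
    moreover have "Dual (laurent_monomial a 0) (of_int (0 $ k) * laurent_monomial a 0) = 1" by (rule dual_eqI) auto
    ultimately show "1 \<in> monomial_graph a k" by metis
    fix y assume "Dual 0 y \<in> monomial_graph a k"
    from monomial_graph_repr[OF this] obtain F c where F: "finite F"
        "0 = (\<Sum>m\<in>F. of_int (c m) * laurent_monomial a m)"
        "y = (\<Sum>m\<in>F. of_int (c m :: int) * (of_int (m $ k) * laurent_monomial a m))"
      by auto
    have "\<forall>m\<in>F. c m = 0" by (rule indep) (use F in auto)
    then show "y = 0" using F(3) by simp
  qed (auto intro: monomial_graph.diff monomial_graph_mult[OF a])
  then obtain D where D: "derivation D" "\<And>x. x \<in> monomial_graph a k \<Longrightarrow> D (re x) = eps x"
    using derivation_extends by blast
  have "D (a $ i) = (if i = k then a $ i else 0)" for i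
    using D(2)[OF monomial_graph.char[of a "axis i 1" k]] unfolding laurent_monomial_axis
    by (simp add: axis_def split: if_splits)
  then show ?thesis using D(1) by blast
qed

section \<open>Compactness: an ultrapower of the coefficient field\<close>

text \<open>Among the proper filters finer than \<open>sequentially\<close>, a finest one exists by Zorn's lemma: the
  infimum of a chain of proper filters is proper. A predicate whose negation is not in it can be
  added without making it improper, so it is there already.\<close>

lemma free_ultrafilter_exists:
  "\<exists>U :: nat filter. U \<le> sequentially \<and> U \<noteq> bot \<and>
     (\<forall>P. eventually P U \<or> eventually (\<lambda>n. \<not> P n) U)"
proof -
  define A where "A = {G :: nat filter. G \<noteq> bot \<and> G \<le> sequentially}"
  have "\<exists>U\<in>A. \<forall>G\<in>A. U \<ge> G \<longrightarrow> G = U"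
  proof (rule predicate_Zorn)
    show "partial_order_on A (relation_of (\<ge>) A)"
      by (rule partial_order_on_relation_ofI) auto
    fix C assume C: "C \<in> Chains (relation_of (\<ge>) A)"
    have CA: "C \<subseteq> A" and chain: "\<And>F G. F \<in> C \<Longrightarrow> G \<in> C \<Longrightarrow> F \<le> G \<or> G \<le> F"
      using C by (auto simp: Chains_def relation_of_def)
    show "\<exists>U\<in>A. \<forall>G\<in>C. G \<ge> U"
    proof (cases "C = {}")
      case True
      have "sequentially \<in> A" by (simp add: A_def)
      then show ?thesis using True by blast
    next
      case False
      have "eventually (\<lambda>_. False) (Inf C) \<longleftrightarrow> (\<exists>F\<in>C. eventually (\<lambda>_. False) F)"
      proof (rule eventually_Inf_base[OF False])
        fix F G assume "F \<in> C" "G \<in> C"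
        with chain[OF this] show "\<exists>x\<in>C. x \<le> inf F G"
          by (metis inf.absorb1 inf.absorb2 order_refl)
      qed
      then have "Inf C \<noteq> bot" using CA by (auto simp: A_def trivial_limit_def)
      moreover have "Inf C \<le> sequentially"
        using False CA by (auto simp: A_def intro: Inf_lower2)
      ultimately show ?thesis by (auto simp: A_def intro: Inf_lower)
    qed
  qed
  then obtain U where U: "U \<in> A" "\<And>G. G \<in> A \<Longrightarrow> G \<le> U \<Longrightarrow> G = U" by blast
  have "eventually P U" if "\<not> eventually (\<lambda>n. \<not> P n) U" for P
  proof -
    have "inf U (principal {n. P n}) \<noteq> bot"
      using that by (simp add: trivial_limit_def eventually_inf_principal)
    then have "inf U (principal {n. P n}) = U"
      using U(1) by (intro U(2)) (auto simp: A_def intro: le_infI1)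
    then show ?thesis by (metis le_principal inf.orderI mem_Collect_eq eventually_mono)
  qed
  then show ?thesis using U(1) by (auto simp: A_def)
qed

text \<open>One ultrafilter is fixed once and for all, since the type of an ultrapower cannot depend on a
  parameter.\<close>

definition free_ultra :: "nat filter" where
  "free_ultra = (SOME U. U \<le> sequentially \<and> U \<noteq> bot \<and>
     (\<forall>P. eventually P U \<or> eventually (\<lambda>n. \<not> P n) U))"

lemma free_ultra:
  "free_ultra \<le> sequentially" "free_ultra \<noteq> bot"
  "eventually P free_ultra \<or> eventually (\<lambda>n. \<not> P n) free_ultra"
  using someI_ex[OF free_ultrafilter_exists] unfolding free_ultra_def[symmetric] by blast+

lemma ultra_not_iff: "eventually (\<lambda>n. \<not> P n) free_ultra \<longleftrightarrow> \<not> eventually P free_ultra"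
proof -
  have "False" if "eventually P free_ultra" "eventually (\<lambda>n. \<not> P n) free_ultra"
  proof -
    have "eventually (\<lambda>_. False) free_ultra" using that by eventually_elim simp
    then show False using free_ultra(2) by simp
  qed
  then show ?thesis using free_ultra(3)[of P] by blast
qed

lemma ultra_disj_iff:
  "eventually (\<lambda>n. P n \<or> Q n) free_ultra \<longleftrightarrow> eventually P free_ultra \<or> eventually Q free_ultra"
proof -
  have "eventually (\<lambda>n. \<not> (P n \<or> Q n)) free_ultra \<longleftrightarrow>
      eventually (\<lambda>n. \<not> P n) free_ultra \<and> eventually (\<lambda>n. \<not> Q n) free_ultra"
    by (simp add: eventually_conj_iff)
  then show ?thesis by (simp only: ultra_not_iff) blast
qed

quotient_type 'a ultrapower = "nat \<Rightarrow> 'a" / "\<lambda>f g. eventually (\<lambda>n. f n = g n) free_ultra"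
proof (rule equivpI)
  show "transp (\<lambda>f g :: nat \<Rightarrow> 'a. \<forall>\<^sub>F n in free_ultra. f n = g n)"
    by (rule transpI) (erule (1) eventually_elim2, simp)
qed (auto simp: reflp_def symp_def eq_commute)

instantiation ultrapower :: (field) field
begin

lift_definition zero_ultrapower :: "'a ultrapower" is "\<lambda>_. 0" .
lift_definition one_ultrapower :: "'a ultrapower" is "\<lambda>_. 1" .
lift_definition plus_ultrapower :: "'a ultrapower \<Rightarrow> 'a ultrapower \<Rightarrow> 'a ultrapower" is
  "\<lambda>f g n. f n + g n" by (erule (1) eventually_elim2) simp
lift_definition minus_ultrapower :: "'a ultrapower \<Rightarrow> 'a ultrapower \<Rightarrow> 'a ultrapower" is
  "\<lambda>f g n. f n - g n" by (erule (1) eventually_elim2) simp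
lift_definition times_ultrapower :: "'a ultrapower \<Rightarrow> 'a ultrapower \<Rightarrow> 'a ultrapower" is
  "\<lambda>f g n. f n * g n" by (erule (1) eventually_elim2) simp
lift_definition divide_ultrapower :: "'a ultrapower \<Rightarrow> 'a ultrapower \<Rightarrow> 'a ultrapower" is
  "\<lambda>f g n. f n / g n" by (erule (1) eventually_elim2) simp
lift_definition uminus_ultrapower :: "'a ultrapower \<Rightarrow> 'a ultrapower" is
  "\<lambda>f n. - f n" by (elim eventually_mono) simp
lift_definition inverse_ultrapower :: "'a ultrapower \<Rightarrow> 'a ultrapower" is
  "\<lambda>f n. inverse (f n)" by (elim eventually_mono) simp

instance
proof
  fix x y w :: "'a ultrapower"
  show "x + y + w = x + (y + w)" by transfer (simp add: add.assoc)
  show "x + y = y + x" by transfer (simp add: add.commute)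
  show "0 + x = x" by transfer simp
  show "- x + x = 0" by transfer simp
  show "x - y = x + - y" by transfer simp
  show "x * y * w = x * (y * w)" by transfer (simp add: mult.assoc)
  show "x * y = y * x" by transfer (simp add: mult.commute)
  show "1 * x = x" by transfer simp
  show "(x + y) * w = x * w + y * w" by transfer (simp add: distrib_right)
  show "(0 :: 'a ultrapower) \<noteq> 1" by transfer (simp add: free_ultra(2))
  show "x div y = x * inverse y" by transfer (simp add: divide_inverse)
  show "inverse (0 :: 'a ultrapower) = 0" by transfer simp
  show "inverse x * x = 1" if "x \<noteq> 0"
    using that by transfer (auto simp: ultra_not_iff[symmetric] elim!: eventually_mono)
qed

end

text \<open>The class of a sequence. It respects the field operations, so polynomial identities that hold for
  almost all indices in the sense of the ultrafilter pass to the ultrapower and back.\<close>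

lift_definition ulim :: "(nat \<Rightarrow> 'a) \<Rightarrow> 'a ultrapower" is "\<lambda>f. f" .

lemma ulim_eq_iff: "ulim f = ulim g \<longleftrightarrow> eventually (\<lambda>n. f n = g n) free_ultra"
  by transfer simp

lemma ulim_0: "ulim (\<lambda>_. 0) = 0" and ulim_1: "ulim (\<lambda>_. 1) = 1"
  by (transfer, simp)+

lemma ulim_eq_0_iff: "ulim f = 0 \<longleftrightarrow> eventually (\<lambda>n. f n = 0) free_ultra"
  by transfer simp

lemma ulim_add: "ulim (\<lambda>n. f n + g n) = ulim f + ulim g"
  and ulim_mult: "ulim (\<lambda>n. f n * g n) = ulim f * ulim g"
  and ulim_uminus: "ulim (\<lambda>n. - f n) = - ulim f"
  and ulim_inverse: "ulim (\<lambda>n. inverse (f n)) = inverse (ulim f)"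
  by (transfer, simp)+

lemma ulim_of_nat: "ulim (\<lambda>_. of_nat m) = of_nat m"
  by (induction m) (simp_all add: ulim_0 ulim_1 ulim_add)

lemma ulim_of_int: "ulim (\<lambda>_. of_int m) = of_int m"
  by (cases m rule: int_cases2) (simp_all add: ulim_of_nat ulim_uminus)

instance ultrapower :: (field_char_0) field_char_0
proof
  show "inj (of_nat :: nat \<Rightarrow> 'a ultrapower)"
    by (rule injI) (simp add: ulim_of_nat[symmetric] ulim_eq_iff free_ultra(2))
qed

lemma ulim_power: "ulim (\<lambda>n. f n ^ m) = ulim f ^ m"
  by (induction m) (simp_all add: ulim_1 ulim_mult)

lemma ulim_powi: "ulim (\<lambda>n. f n powi m) = ulim f powi m"
  by (cases m rule: int_cases2) (simp_all add: ulim_power ulim_inverse power_int_minus)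

lemma ulim_sum: "ulim (\<lambda>n. \<Sum>i\<in>A. f i n) = (\<Sum>i\<in>A. ulim (f i))"
  by (induction A rule: infinite_finite_induct) (simp_all add: ulim_0 ulim_add)

lemma ulim_prod: "ulim (\<lambda>n. \<Prod>i\<in>A. f i n) = (\<Prod>i\<in>A. ulim (f i))"
  by (induction A rule: infinite_finite_induct) (simp_all add: ulim_1 ulim_mult)

definition vec_ulim :: "(nat \<Rightarrow> 'a ^ 'n) \<Rightarrow> 'a ultrapower ^ 'n" where
  "vec_ulim v = (\<chi> j. ulim (\<lambda>n. v n $ j))"

lemma vec_ulim_nth [simp]: "vec_ulim v $ j = ulim (\<lambda>n. v n $ j)"
  by (simp add: vec_ulim_def)

lemma vec_ulim_eq_iff:
  fixes v w :: "nat \<Rightarrow> 'a ^ 'n::finite"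
  shows "vec_ulim v = vec_ulim w \<longleftrightarrow> eventually (\<lambda>n. v n = w n) free_ultra"
  using eventually_ball_finite_distrib[of UNIV "\<lambda>n j. v n $ j = w n $ j" free_ultra]
  by (simp add: vec_eq_iff ulim_eq_iff)

lemma ulim_laurent_monomial: "ulim (\<lambda>n. laurent_monomial (v n) m) = laurent_monomial (vec_ulim v) m"
  by (simp add: laurent_monomial_def ulim_prod ulim_powi)

lemma ulim_log_value: "ulim (\<lambda>n. log_value e (a n) (z n)) = log_value e (vec_ulim a) (vec_ulim z)"
  by (simp add: log_value_def ulim_sum ulim_mult ulim_laurent_monomial)

lemma log_critical_ulim:
  assumes "eventually (\<lambda>n. log_critical e (a n) (z n)) free_ultra"
  shows "log_critical e (vec_ulim a) (vec_ulim z)"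
  unfolding log_critical_def
proof (intro conjI allI)
  fix j
  have "eventually (\<lambda>n. z n $ j \<noteq> 0) free_ultra"
    using assms by eventually_elim (simp add: log_critical_def)
  then show "vec_ulim z $ j \<noteq> 0" by (simp add: ulim_eq_0_iff ultra_not_iff)
  have "ulim (\<lambda>n. \<Sum>i\<in>UNIV. of_int (e i $ j) * (a n $ i * laurent_monomial (z n) (e i))) = 0"
    unfolding ulim_eq_0_iff using assms by eventually_elim (simp add: log_critical_def)
  then show "(\<Sum>i\<in>UNIV. of_int (e i $ j) * (vec_ulim a $ i * laurent_monomial (vec_ulim z) (e i))) = 0"
    by (simp add: ulim_sum ulim_mult ulim_of_int ulim_laurent_monomial)
qed

lemma log_hessian_ulim:
  "(vec_ulim y v* log_hessian e (vec_ulim a) (vec_ulim z)) = vec_ulim (\<lambda>n. y n v* log_hessian e (a n) (z n))"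
  by (simp add: vec_eq_iff vector_matrix_mult_def log_hessian_def ulim_sum ulim_mult ulim_of_int ulim_laurent_monomial)

text \<open>Compactness. Each nontrivial integer combination of monomials is assumed to vanish only for finitely many
  members of the sequence of coefficient vectors. In the ultrapower the monomials in their limit
  are then independent, so derivations are available there, and the limit coefficients cannot
  have a degenerate critical point, a zero critical value or a repeated critical value. Choosing
  such a defect for each member of the sequence would produce one of the same kind in the limit,
  because the ultrafilter singles out one of the three kinds.\<close>

lemma independent_sequence_has_morse_coeffs:
  fixes a :: "nat \<Rightarrow> 'a::field_char_0 ^ 'r::finite" and e :: "'r \<Rightarrow> int ^ 'n::finite"
  assumes C: "\<And>j l. (\<Sum>i\<in>UNIV. C j i * e i $ l) = (if j = l then 1 else 0)"
    and a: "\<And>n i. a n $ i \<noteq> 0"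
    and indep: "\<And>F c m. finite F \<Longrightarrow> m \<in> F \<Longrightarrow> c m \<noteq> (0::int) \<Longrightarrow>
      eventually (\<lambda>n. (\<Sum>m\<in>F. of_int (c m) * laurent_monomial (a n) m) \<noteq> 0) sequentially"
  shows "\<exists>n. morse_coeffs e (a n)"
proof (rule ccontr)
  assume "\<not> ?thesis"
  then have "\<forall>n. \<exists>z w y. log_critical e (a n) z \<and> (log_value e (a n) z = 0 \<or>
      (log_critical e (a n) w \<and> log_value e (a n) z = log_value e (a n) w \<and> z \<noteq> w) \<or>
      (y v* log_hessian e (a n) z = 0 \<and> y \<noteq> 0))"
    unfolding morse_coeffs_def by blast
  then obtain z w y where bad: "\<And>n. log_critical e (a n) (z n) \<and> (log_value e (a n) (z n) = 0 \<or>
      (log_critical e (a n) (w n) \<and> log_value e (a n) (z n) = log_value e (a n) (w n) \<and> z n \<noteq> w n) \<or>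
      (y n v* log_hessian e (a n) (z n) = 0 \<and> y n \<noteq> 0))"
    by metis
  let ?a = "vec_ulim a" and ?z = "vec_ulim z"
  have a': "?a $ i \<noteq> 0" for i using a by (simp add: ulim_eq_0_iff free_ultra(2))
  have "\<forall>m\<in>F. c m = 0"
    if "finite F" "(\<Sum>m\<in>F. of_int (c m) * laurent_monomial ?a m) = 0" for F and c :: "_ \<Rightarrow> int"
  proof (rule ccontr)
    assume "\<not> (\<forall>m\<in>F. c m = 0)"
    then obtain m where "m \<in> F" "c m \<noteq> 0" by blast
    from filter_leD[OF free_ultra(1) indep[where c = c, OF that(1) this]]
    have "ulim (\<lambda>n. \<Sum>m\<in>F. of_int (c m) * laurent_monomial (a n) m) \<noteq> 0"
      by (simp add: ulim_eq_0_iff ultra_not_iff)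
    then show False using that(2) by (simp add: ulim_sum ulim_mult ulim_of_int ulim_laurent_monomial)
  qed
  from derivations_of_independent[OF a' this]
  have "\<forall>k. \<exists>D. derivation D \<and> (\<forall>i. D (?a $ i) = (if i = k then ?a $ i else 0))" by blast
  then obtain D where D: "\<And>k. derivation (D k)" "\<And>k i. D k (?a $ i) = (if i = k then ?a $ i else 0)"
    by metis
  interpret toric_derivations e C ?a D
    by unfold_locales (fact C a' D)+
  have crit: "log_critical e ?a ?z" using bad by (intro log_critical_ulim) auto
  have "eventually (\<lambda>n. log_value e (a n) (z n) = 0) free_ultra \<or>
      eventually (\<lambda>n. log_critical e (a n) (w n) \<and> log_value e (a n) (z n) = log_value e (a n) (w n) \<and> z n \<noteq> w n) free_ultra \<or>
      eventually (\<lambda>n. y n v* log_hessian e (a n) (z n) = 0 \<and> y n \<noteq> 0) free_ultra"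
    unfolding ultra_disj_iff[symmetric] using bad by simp
  then show False
  proof (elim disjE)
    assume "eventually (\<lambda>n. log_value e (a n) (z n) = 0) free_ultra"
    then have "log_value e ?a ?z = 0" by (simp add: ulim_eq_0_iff flip: ulim_log_value)
    then show False using coeffs_morse crit by (auto simp: morse_coeffs_def)
  next
    assume *: "eventually (\<lambda>n. log_critical e (a n) (w n) \<and> log_value e (a n) (z n) = log_value e (a n) (w n) \<and> z n \<noteq> w n) free_ultra"
    then have "log_critical e ?a (vec_ulim w)" by (intro log_critical_ulim) (auto elim: eventually_mono)
    moreover have "log_value e ?a ?z = log_value e ?a (vec_ulim w)"
      using * by (auto simp: ulim_eq_iff elim: eventually_mono simp flip: ulim_log_value)
    ultimately have "?z = vec_ulim w" using coeffs_morse crit by (auto simp: morse_coeffs_def)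
    moreover have "eventually (\<lambda>n. z n \<noteq> w n) free_ultra" using * by (auto elim: eventually_mono)
    ultimately show False by (simp add: vec_ulim_eq_iff ultra_not_iff)
  next
    assume *: "eventually (\<lambda>n. y n v* log_hessian e (a n) (z n) = 0 \<and> y n \<noteq> 0) free_ultra"
    then have "vec_ulim (\<lambda>n. y n v* log_hessian e (a n) (z n)) = vec_ulim (\<lambda>n. 0)"
      unfolding vec_ulim_eq_iff by (auto elim: eventually_mono)
    then have "vec_ulim y v* log_hessian e ?a ?z = 0"
      unfolding log_hessian_ulim by (simp add: vec_eq_iff ulim_0)
    then have "vec_ulim y = 0" using coeffs_morse crit by (auto simp: morse_coeffs_def)
    then have "vec_ulim y = vec_ulim (\<lambda>n. 0)" by (simp add: vec_eq_iff ulim_0)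
    moreover have "eventually (\<lambda>n. y n \<noteq> 0) free_ultra" using * by (auto elim: eventually_mono)
    ultimately show False unfolding vec_ulim_eq_iff ultra_not_iff by blast
  qed
qed

section \<open>The coefficients of the superpotential\<close>

definition s_const :: "real \<Rightarrow> 'k::field novikov fls" where
  "s_const v = fls_const (s_powr v)"

lemma s_const_0: "s_const 0 = 1"
  by (simp add: s_const_def nov_monom_one)

lemma s_const_add: "s_const (v + w) = s_const v * s_const w"
  by (simp add: s_const_def nov_monom_mult fls_const_mult_const)

lemma s_const_nz [simp]: "s_const v \<noteq> (0 :: 'k::field novikov fls)"
proof
  assume "s_const v = (0 :: 'k novikov fls)"
  then have "s_const (v + - v) = (0 :: 'k novikov fls)" unfolding s_const_add by simp
  then show False by (simp add: s_const_0)
qed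

lemma s_const_powi: "s_const v powi n = s_const (of_int n * v)"
proof -
  have nat: "s_const v ^ k = s_const (of_nat k * v)" for k
    by (induction k) (simp_all add: s_const_0 s_const_add distrib_right)
  have "inverse (s_const v) = s_const (- v)" for v
    by (rule inverse_unique) (simp add: s_const_0 flip: s_const_add)
  then show ?thesis
    by (cases n rule: int_cases2) (simp_all add: nat power_int_minus)
qed

lemma s_const_sum: "s_const (\<Sum>i\<in>A. f i) = (\<Prod>i\<in>A. s_const (f i))"
  by (induction A rule: infinite_finite_induct) (simp_all add: s_const_0 s_const_add)

lemma of_int_s_const: "of_int n * s_const v = fls_const (nov_monom (of_int n) v)"
proof -
  have "of_nat k = nov_monom (of_nat k :: 'a) 0" for k
    by (rule novikov_eqI) (simp add: nov_coeff_of_nat nov_monom.rep_eq)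
  moreover have "- nov_monom b w = nov_monom (- b :: 'a) w" for b w
    by (rule novikov_eqI) (simp add: uminus_novikov.rep_eq nov_monom.rep_eq)
  ultimately have "of_int n = nov_monom (of_int n :: 'a) 0"
    by (cases n rule: int_cases2) simp_all
  then show ?thesis
    by (simp add: s_const_def fls_of_int fls_const_mult_const nov_monom_mult)
qed

text \<open>Distinct exponents of \<open>s\<close> cannot cancel; it suffices to compare coefficients at \<open>T\<^sup>0\<close> and then at
  \<open>s\<^bsup>w m\<^esup>\<close>.\<close>

lemma sum_s_const_nz:
  fixes c :: "'b \<Rightarrow> int"
  assumes F: "finite F" "m \<in> F" "c m \<noteq> 0" and inj: "inj_on w F"
  shows "(\<Sum>m\<in>F. of_int (c m) * s_const (w m) :: 'k::field_char_0 novikov fls) \<noteq> 0"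
proof
  assume "(\<Sum>m\<in>F. of_int (c m) * s_const (w m) :: 'k novikov fls) = 0"
  then have "fls_nth (\<Sum>m\<in>F. fls_const (nov_monom (of_int (c m) :: 'k) (w m))) 0 = 0"
    by (simp add: of_int_s_const)
  then have "nov_coeff (\<Sum>m\<in>F. nov_monom (of_int (c m) :: 'k) (w m)) (w m) = nov_coeff 0 (w m)"
    by (simp add: fls_nth_sum)
  then have "(\<Sum>m'\<in>F. if w m = w m' then of_int (c m') else (0 :: 'k)) = 0"
    by (simp add: nov_coeff_sum nov_monom.rep_eq zero_novikov.rep_eq)
  also have "(\<Sum>m'\<in>F. if w m = w m' then of_int (c m') else (0 :: 'k)) =
      (\<Sum>m'\<in>F. if m = m' then of_int (c m') else 0)"
    using inj F by (intro sum.cong) (auto simp: inj_on_def)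
  finally show False using F by simp
qed

definition edge_coeffs :: "real ^ 'r::finite \<Rightarrow> 'k::field novikov fls ^ 'r" where
  "edge_coeffs x = (\<chi> i. s_const (- x $ i))"

lemma edge_coeffs_nth [simp]: "edge_coeffs x $ i = s_const (- x $ i)"
  by (simp add: edge_coeffs_def)

lemma laurent_monomial_edge_coeffs: "laurent_monomial (edge_coeffs x) m = s_const (- (\<Sum>i\<in>UNIV. of_int (m $ i) * x $ i))"
  by (simp add: laurent_monomial_def s_const_powi s_const_sum flip: sum_negf)

text \<open>The bound \<open>k\<close> leaves finitely many hyperplanes, so that these sets are open; they decrease with
  \<open>k\<close>, and their intersection consists of the vectors whose entries are independent over the
  rationals.\<close>

definition off_hyperplanes :: "nat \<Rightarrow> (real ^ 'r::finite) set" where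
  "off_hyperplanes k = {x. \<forall>m :: int ^ 'r. m \<noteq> 0 \<longrightarrow> (\<forall>i. \<bar>m $ i\<bar> \<le> int k) \<longrightarrow>
     (\<Sum>i\<in>UNIV. of_int (m $ i) * x $ i) \<noteq> 0}"

lemma lattice_avoidingD:
  fixes m :: "int ^ 'r::finite"
  assumes "x \<in> off_hyperplanes k" "m \<noteq> 0" "\<And>i. \<bar>m $ i\<bar> \<le> int k"
  shows "(\<Sum>i\<in>UNIV. of_int (m $ i) * x $ i) \<noteq> 0"
  using assms unfolding off_hyperplanes_def by blast

text \<open>Otherwise there is a sequence of counterexamples \<open>x k\<close> off more and more hyperplanes. Two monomials
  in the coefficients \<open>s\<^bsup>-x\<^sub>i\<^esup>\<close> coincide only if \<open>x\<close> lies on the hyperplane given by the difference of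
  their exponents, so along the sequence any finitely many monomials become independent.\<close>

lemma morse_coeffs_off_hyperplanes:
  fixes e :: "'r::finite \<Rightarrow> int ^ 'n::finite"
  assumes C: "\<And>j l. (\<Sum>i\<in>UNIV. C j i * e i $ l) = (if j = l then 1 else 0)"
  shows "\<exists>k. \<forall>x\<in>off_hyperplanes k. morse_coeffs e (edge_coeffs x :: 'k::field_char_0 novikov fls ^ 'r)"
proof (rule ccontr)
  assume "\<not> ?thesis"
  then have "\<forall>k. \<exists>x. x \<in> off_hyperplanes k \<and>
      \<not> morse_coeffs e (edge_coeffs x :: 'k novikov fls ^ 'r)" by blast
  then obtain x where x: "\<And>k. x k \<in> off_hyperplanes k"
    "\<And>k. \<not> morse_coeffs e (edge_coeffs (x k) :: 'k novikov fls ^ 'r)" by metis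
  have "\<exists>k. morse_coeffs e (edge_coeffs (x k) :: 'k novikov fls ^ 'r)"
  proof (rule independent_sequence_has_morse_coeffs[OF C])
    show "(edge_coeffs (x k) :: 'k novikov fls ^ 'r) $ i \<noteq> 0" for k i by simp
  next
    fix F and c :: "int ^ 'r \<Rightarrow> int" and m
    assume F: "finite F" "m \<in> F" "c m \<noteq> 0"
    let ?S = "(\<lambda>(m, m', i). nat \<bar>m $ i - m' $ i\<bar>) ` (F \<times> F \<times> UNIV)"
    define K where "K = Max ?S"
    have K: "nat \<bar>m $ i - m' $ i\<bar> \<le> K" if "m \<in> F" "m' \<in> F" for m m' i
      unfolding K_def using that F(1) by (intro Max_ge) force+
    have "(\<Sum>m\<in>F. of_int (c m) * laurent_monomial (edge_coeffs (x k) :: 'k novikov fls ^ 'r) m) \<noteq> 0"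
      if "K \<le> k" for k
    proof -
      have inj: "inj_on (\<lambda>m. - (\<Sum>i\<in>UNIV. of_int (m $ i) * x k $ i)) F"
      proof (rule inj_onI, rule ccontr)
        fix m m' assume m: "m \<in> F" "m' \<in> F" "m \<noteq> m'"
          "- (\<Sum>i\<in>UNIV. of_int (m $ i) * x k $ i) = - (\<Sum>i\<in>UNIV. of_int (m' $ i) * x k $ i)"
        \<comment> \<open>The difference \<open>m - m'\<close> defines one of the hyperplanes that \<open>x k\<close> avoids.\<close>
        have "(m - m') $ i \<le> int k \<and> - (m - m') $ i \<le> int k" for i
          using K[OF m(1,2), of i] \<open>K \<le> k\<close> by auto
        then have "\<bar>(m - m') $ i\<bar> \<le> int k" for i by (metis abs_le_iff)
        then have "(\<Sum>i\<in>UNIV. of_int ((m - m') $ i) * x k $ i) \<noteq> 0"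
          by (intro lattice_avoidingD[OF x(1)[of k]]) (use m(3) in auto)
        then show False using m(4) by (simp add: left_diff_distrib sum_subtractf sum_negf)
      qed
      show ?thesis
        using sum_s_const_nz[where c = c, OF F inj] by (simp only: laurent_monomial_edge_coeffs)
    qed
    then show "eventually (\<lambda>k. (\<Sum>m\<in>F. of_int (c m) *
        laurent_monomial (edge_coeffs (x k) :: 'k novikov fls ^ 'r) m) \<noteq> 0) sequentially"
      unfolding eventually_sequentially by blast
  qed
  then show False using x(2) by blast
qed

section \<open>The superpotential in logarithmic form\<close>

lemma laurent_eval_superset:
  assumes "finite A" "Poly_Mapping.keys p \<subseteq> A"
  shows "laurent_eval p z = (\<Sum>m\<in>A. Poly_Mapping.lookup p m * laurent_monomial z m)"
  unfolding laurent_eval_def laurent_monomial_def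
  by (rule sum.mono_neutral_left) (use assms in \<open>auto simp: in_keys_iff\<close>)

lemma laurent_eval_add: "laurent_eval (p + q) z = laurent_eval p z + laurent_eval q z"
proof -
  let ?A = "Poly_Mapping.keys p \<union> Poly_Mapping.keys q"
  have "Poly_Mapping.keys (p + q) \<subseteq> ?A" by (rule keys_add)
  then show ?thesis
    by (simp add: laurent_eval_superset[of ?A] lookup_add distrib_right sum.distrib)
qed

lemma laurent_eval_single: "laurent_eval (Poly_Mapping.single m c) z = c * laurent_monomial z m"
  by (subst laurent_eval_superset[of "{m}"]) auto

lemma laurent_eval_sum: "laurent_eval (\<Sum>i\<in>I. p i) z = (\<Sum>i\<in>I. laurent_eval (p i) z)"
  by (induction I rule: infinite_finite_induct)
    (simp_all add: laurent_eval_add, simp_all add: laurent_eval_def)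

lemma laurent_deriv_superset:
  assumes "finite A" "Poly_Mapping.keys p \<subseteq> A"
  shows "laurent_deriv j p = (\<Sum>m\<in>A. Poly_Mapping.single (m - axis j 1) (of_int (m $ j) * Poly_Mapping.lookup p m))"
  unfolding laurent_deriv_def
  by (rule sum.mono_neutral_left) (use assms in \<open>auto simp: in_keys_iff\<close>)

lemma laurent_deriv_add: "laurent_deriv j (p + q) = laurent_deriv j p + laurent_deriv j q"
proof -
  let ?A = "Poly_Mapping.keys p \<union> Poly_Mapping.keys q"
  have "Poly_Mapping.keys (p + q) \<subseteq> ?A" by (rule keys_add)
  then show ?thesis
    by (simp add: laurent_deriv_superset[of ?A] lookup_add distrib_left single_add sum.distrib)
qed

lemma laurent_deriv_single:
  "laurent_deriv j (Poly_Mapping.single m c) = Poly_Mapping.single (m - axis j 1) (of_int (m $ j) * c)"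
  by (subst laurent_deriv_superset[of "{m}"]) auto

lemma laurent_deriv_sum: "laurent_deriv j (\<Sum>i\<in>I. p i) = (\<Sum>i\<in>I. laurent_deriv j (p i))"
  by (induction I rule: infinite_finite_induct)
    (simp_all add: laurent_deriv_add, simp_all add: laurent_deriv_def)

lemma laurent_monomial_diff_axis:
  assumes "\<And>j. z $ j \<noteq> 0"
  shows "laurent_monomial z (m - axis j 1) = laurent_monomial z m / z $ j"
  using laurent_monomial_add[OF assms, of "m - axis j 1" "axis j 1"] assms[of j] by (simp add: laurent_monomial_axis)

context
  fixes e :: "'r::finite \<Rightarrow> int ^ 'n::finite" and x :: "real ^ 'r"
    and W :: "('n, 'k::field_char_0 novikov fls) laurent_poly" and a :: "'k novikov fls ^ 'r"
  defines "W \<equiv> superpotential e x" and "a \<equiv> edge_coeffs x"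
begin

lemma superpotential_eq: "W = (\<Sum>i\<in>UNIV. Poly_Mapping.single (e i) (a $ i * fls_X))"
  by (simp add: W_def superpotential_def a_def s_const_def)

lemma laurent_eval_W: "laurent_eval W z = fls_X * log_value e a z"
  by (simp add: superpotential_eq laurent_eval_sum laurent_eval_single log_value_def sum_distrib_left mult_ac)

lemma laurent_eval_deriv_W:
  assumes "\<And>j. z $ j \<noteq> 0"
  shows "laurent_eval (laurent_deriv j W) z =
    fls_X / z $ j * (\<Sum>i\<in>UNIV. of_int (e i $ j) * (a $ i * laurent_monomial z (e i)))"
  by (simp add: superpotential_eq laurent_deriv_sum laurent_deriv_single laurent_eval_sum laurent_eval_single
      laurent_monomial_diff_axis[OF assms] sum_distrib_left mult_ac)

lemma critical_points_W: "critical_points W = {z. log_critical e a z}"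
  by (auto simp: critical_points_def log_critical_def laurent_eval_deriv_W)

text \<open>The second derivatives differ from the logarithmic ones by a multiple of the first derivatives,
  which vanish at a critical point.\<close>

lemma hessian_W:
  assumes z: "log_critical e a z"
  shows "hessian W z $ i $ j = fls_X / (z $ i * z $ j) * log_hessian e a z $ i $ j"
proof -
  have nz: "z $ j \<noteq> 0" for j using z by (simp add: log_critical_def)
  define b where "b k = a $ k * laurent_monomial z (e k)" for k
  have "hessian W z $ i $ j = (\<Sum>k\<in>UNIV. of_int (e k $ i - axis j 1 $ i) * (of_int (e k $ j) * (a $ k * fls_X))
      * (laurent_monomial z (e k) / z $ j / z $ i))"
    by (simp add: hessian_def superpotential_eq laurent_deriv_sum laurent_deriv_single laurent_eval_sum
        laurent_eval_single laurent_monomial_diff_axis[OF nz])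
  also have "\<dots> = (\<Sum>k\<in>UNIV. fls_X / (z $ i * z $ j) * (of_int (e k $ i) * of_int (e k $ j) * b k)
      - fls_X / (z $ i * z $ j) * of_int (axis j 1 $ i) * (of_int (e k $ j) * b k))"
    by (intro sum.cong) (simp_all add: b_def field_simps nz)
  also have "\<dots> = fls_X / (z $ i * z $ j) * (\<Sum>k\<in>UNIV. of_int (e k $ i) * of_int (e k $ j) * b k)
      - fls_X / (z $ i * z $ j) * of_int (axis j 1 $ i) * (\<Sum>k\<in>UNIV. of_int (e k $ j) * b k)"
    by (simp only: sum_subtractf sum_distrib_left)
  also have "(\<Sum>k\<in>UNIV. of_int (e k $ j) * b k) = 0" using z by (simp add: log_critical_def b_def)
  finally show ?thesis by (simp add: log_hessian_def b_def)
qed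

lemma superpotential_morse_distinct_nonzero:
  assumes good: "morse_coeffs e a"
  shows "morse W \<and> inj_on (laurent_eval W) (critical_points W) \<and>
    (\<forall>p\<in>critical_points W. laurent_eval W p \<noteq> 0)"
proof (intro conjI ballI)
  show "inj_on (laurent_eval W) (critical_points W)"
    using good by (auto simp: inj_on_def critical_points_W laurent_eval_W morse_coeffs_def)
  show "laurent_eval W p \<noteq> 0" if "p \<in> critical_points W" for p
    using good that by (auto simp: critical_points_W laurent_eval_W morse_coeffs_def)
  show "morse W"
    unfolding morse_def
  proof
    fix z assume "z \<in> critical_points W"
    then have z: "log_critical e a z" by (simp add: critical_points_W)
    then have nz: "z $ j \<noteq> 0" for j by (simp add: log_critical_def)
    have "u = 0" if u: "hessian W z *v u = 0" for u
    proof -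
      define y where "y = (\<chi> j. u $ j / z $ j)"
      have "(y v* log_hessian e a z) $ i = 0" for i
      proof -
        have "0 = (\<Sum>j\<in>UNIV. hessian W z $ i $ j * u $ j)"
          using u by (simp add: vec_eq_iff matrix_vector_mult_def)
        also have "\<dots> = (\<Sum>j\<in>UNIV. fls_X / z $ i * (log_hessian e a z $ j $ i * y $ j))"
        proof (rule sum.cong[OF refl])
          fix j
          have "log_hessian e a z $ i $ j = log_hessian e a z $ j $ i" by (simp add: log_hessian_def mult_ac)
          then show "hessian W z $ i $ j * u $ j = fls_X / z $ i * (log_hessian e a z $ j $ i * y $ j)"
            by (simp add: hessian_W[OF z] y_def)
        qed
        also have "\<dots> = fls_X / z $ i * (y v* log_hessian e a z) $ i"
          by (simp add: vector_matrix_mult_def sum_distrib_left mult_ac)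
        finally show ?thesis using nz by simp
      qed
      then have "y v* log_hessian e a z = 0" by (simp add: vec_eq_iff)
      then have "y = 0" using good z by (simp add: morse_coeffs_def)
      then show "u = 0" using nz by (simp add: vec_eq_iff y_def)
    qed
    then have "\<exists>B. B ** hessian W z = mat 1" by (simp add: matrix_left_invertible_ker)
    then show "det (hessian W z) \<noteq> 0"
      by (simp add: invertible_left_inverse flip: invertible_det_nz)
  qed
qed

end

section \<open>Complements of finitely many rational hyperplanes\<close>

lemma finite_bounded_lattice_vectors:
  "finite {m :: int ^ 'r::finite. m \<noteq> 0 \<and> (\<forall>i. \<bar>m $ i\<bar> \<le> int k)}"
proof -
  have "{m :: int ^ 'r. m \<noteq> 0 \<and> (\<forall>i. \<bar>m $ i\<bar> \<le> int k)}
      \<subseteq> vec_lambda ` (UNIV \<rightarrow>\<^sub>E {- int k..int k})"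
  proof
    fix m :: "int ^ 'r" assume "m \<in> {m. m \<noteq> 0 \<and> (\<forall>i. \<bar>m $ i\<bar> \<le> int k)}"
    then have "vec_nth m \<in> UNIV \<rightarrow>\<^sub>E {- int k..int k}" by (auto simp: abs_le_iff minus_le_iff)
    then show "m \<in> vec_lambda ` (UNIV \<rightarrow>\<^sub>E {- int k..int k})" by (metis image_eqI vec_nth_inverse)
  qed
  then show ?thesis by (rule finite_subset) (simp add: finite_PiE)
qed

lemma off_hyperplanes_eq:
  "off_hyperplanes k = - (\<Union>m\<in>{m :: int ^ 'r::finite. m \<noteq> 0 \<and> (\<forall>i. \<bar>m $ i\<bar> \<le> int k)}. {x. real_vec m \<bullet> x = 0})"
  by (auto simp: off_hyperplanes_def inner_vec_def real_vec_def)

lemma open_off_hyperplanes: "open (off_hyperplanes k)"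
  unfolding off_hyperplanes_eq
  by (intro open_Compl closed_UN finite_bounded_lattice_vectors) (auto intro: closed_hyperplane)

text \<open>A finite union of hyperplanes has measure zero and hence empty interior.\<close>

lemma open_subset_closure_off_hyperplanes:
  fixes A :: "(real ^ 'r::finite) set"
  assumes "open A"
  shows "A \<subseteq> closure (A \<inter> off_hyperplanes k)"
proof -
  let ?N = "\<Union>m\<in>{m :: int ^ 'r. m \<noteq> 0 \<and> (\<forall>i. \<bar>m $ i\<bar> \<le> int k)}. {x. real_vec m \<bullet> x = 0}"
  have "negligible ?N"
  proof (rule negligible_Union)
    show "negligible H" if "H \<in> (\<lambda>m. {x. real_vec m \<bullet> x = 0}) ` {m :: int ^ 'r. m \<noteq> 0 \<and> (\<forall>i. \<bar>m $ i\<bar> \<le> int k)}" for H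
    proof -
      obtain m :: "int ^ 'r" where m: "m \<noteq> 0" "H = {x. real_vec m \<bullet> x = 0}" using \<open>H \<in> _\<close> by blast
      have "real_vec m \<noteq> 0" using m(1) by (simp add: real_vec_def vec_eq_iff)
      then show ?thesis unfolding m(2) by (intro negligible_hyperplane) simp
    qed
  qed (intro finite_imageI finite_bounded_lattice_vectors)
  then have "interior ?N = {}"
    using open_not_negligible[of "interior ?N"] negligible_subset[OF _ interior_subset] by blast
  then have "closure (off_hyperplanes k) = (UNIV :: (real ^ 'r) set)"
    unfolding off_hyperplanes_eq closure_complement by simp
  then show ?thesis
    using open_Int_closure_subset[OF assms, of "off_hyperplanes k"] by simp
qed

section \<open>Symplectic forms on a smooth complete toric variety\<close>

text \<open>The cone \<open>\<sigma>\<close> is spanned by the part \<open>I\<close> of the lattice basis \<open>b\<close>. Carrying the dual basis \<open>d\<close> along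
  describes the cone, and below its faces, by conditions on coordinates.\<close>

definition lattice_simplicial ::
  "('n::finite \<Rightarrow> int ^ 'n) \<Rightarrow> ('n \<Rightarrow> int ^ 'n) \<Rightarrow> 'n set \<Rightarrow> (real ^ 'n) set \<Rightarrow> bool" where
  "lattice_simplicial b d I \<sigma> \<longleftrightarrow>
     (\<forall>i j. real_vec (b i) \<bullet> real_vec (d j) = (if i = j then 1 else 0)) \<and>
     (\<forall>x. x = (\<Sum>i\<in>UNIV. (x \<bullet> real_vec (d i)) *\<^sub>R real_vec (b i))) \<and>
     \<sigma> = {x. \<forall>i. 0 \<le> x \<bullet> real_vec (d i) \<and> (i \<notin> I \<longrightarrow> x \<bullet> real_vec (d i) = 0)}"

lemma real_vec_inner: "real_vec v \<bullet> real_vec w = of_int (\<Sum>l\<in>UNIV. v $ l * w $ l)"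
  by (simp add: real_vec_def inner_vec_def)

lemma dual_basis_of_invertible:
  fixes B :: "int ^ 'n::finite ^ 'n"
  assumes "invertible B"
  shows "\<exists>d :: 'n \<Rightarrow> int ^ 'n.
    (\<forall>i j. real_vec (row i B) \<bullet> real_vec (d j) = (if i = j then 1 else 0)) \<and>
    (\<forall>x. x = (\<Sum>i\<in>UNIV. (x \<bullet> real_vec (d i)) *\<^sub>R real_vec (row i B)))"
proof -
  obtain B' where B': "B ** B' = mat 1" "B' ** B = mat 1" using assms by (auto simp: invertible_def)
  show ?thesis
  proof (rule exI[of _ "\<lambda>i. column i B'"], intro conjI allI)
    show "real_vec (row i B) \<bullet> real_vec (column j B') = (if i = j then 1 else 0)" for i j
    proof -
      have "(B ** B') $ i $ j = (mat 1 :: int ^ 'n ^ 'n) $ i $ j" by (simp add: B')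
      then show ?thesis
        by (simp add: real_vec_inner row_def column_def matrix_matrix_mult_def mat_def)
    qed
    fix x :: "real ^ 'n"
    have "x $ k = (\<Sum>i\<in>UNIV. (x \<bullet> real_vec (column i B')) *\<^sub>R real_vec (row i B)) $ k" for k
    proof -
      have "(\<Sum>i\<in>UNIV. B' $ l $ i * B $ i $ k) = (if l = k then 1 else 0)" for l
      proof -
        have "(B' ** B) $ l $ k = (mat 1 :: int ^ 'n ^ 'n) $ l $ k" by (simp add: B')
        then show ?thesis by (simp add: matrix_matrix_mult_def mat_def)
      qed
      then have *: "(\<Sum>i\<in>UNIV. real_of_int (B' $ l $ i) * of_int (B $ i $ k)) = (if l = k then 1 else 0)" for l
        by (simp flip: of_int_mult of_int_sum)
      have "(\<Sum>i\<in>UNIV. (x \<bullet> real_vec (column i B')) *\<^sub>R real_vec (row i B)) $ k =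
          (\<Sum>i\<in>UNIV. \<Sum>l\<in>UNIV. x $ l * (real_of_int (B' $ l $ i) * of_int (B $ i $ k)))"
        by (simp add: inner_vec_def real_vec_def row_def column_def sum_distrib_right mult.assoc)
      also have "\<dots> = (\<Sum>l\<in>UNIV. x $ l * (\<Sum>i\<in>UNIV. real_of_int (B' $ l $ i) * of_int (B $ i $ k)))"
        by (subst sum.swap) (simp add: sum_distrib_left)
      also have "\<dots> = x $ k" by (simp add: * if_distrib cong: if_cong)
      finally show ?thesis ..
    qed
    then show "x = (\<Sum>i\<in>UNIV. (x \<bullet> real_vec (column i B')) *\<^sub>R real_vec (row i B))"
      by (simp add: vec_eq_iff)
  qed
qed

lemma convex_cone_sum:
  assumes "convex_cone S" "\<And>i. i \<in> A \<Longrightarrow> f i \<in> S"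
  shows "sum f A \<in> S"
  using assms(2)
  by (induction A rule: infinite_finite_induct)
    (auto intro: convex_cone_add[OF assms(1)] convex_cone_contains_0[OF assms(1)])

lemma convex_cone_hull_basis:
  fixes b :: "'n::finite \<Rightarrow> real ^ 'n"
  assumes dual: "\<And>i j. b i \<bullet> d j = (if i = j then 1 else 0)"
    and expand: "\<And>x. x = (\<Sum>i\<in>UNIV. (x \<bullet> d i) *\<^sub>R b i)"
  shows "convex_cone hull (b ` I) = {x. \<forall>i. 0 \<le> x \<bullet> d i \<and> (i \<notin> I \<longrightarrow> x \<bullet> d i = 0)}" (is "_ = ?C")
proof (rule antisym)
  show "convex_cone hull (b ` I) \<subseteq> ?C"
  proof (rule hull_minimal)
    show "b ` I \<subseteq> ?C" by (auto simp: dual)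
    show "convex_cone ?C" by (auto simp: convex_cone_iff inner_add_left)
  qed
  show "?C \<subseteq> convex_cone hull (b ` I)"
  proof
    fix x assume x: "x \<in> ?C"
    have "(x \<bullet> d i) *\<^sub>R b i \<in> convex_cone hull (b ` I)" for i
    proof (cases "i \<in> I")
      case True
      then show ?thesis using x
        by (intro convex_cone_scaleR[OF convex_cone_convex_cone_hull]) (auto intro: hull_inc)
    next
      case False
      then show ?thesis using x by (simp add: convex_cone_hull_contains_0)
    qed
    then have "(\<Sum>i\<in>UNIV. (x \<bullet> d i) *\<^sub>R b i) \<in> convex_cone hull (b ` I)"
      by (intro convex_cone_sum[OF convex_cone_convex_cone_hull]) auto
    then show "x \<in> convex_cone hull (b ` I)" by (simp flip: expand)
  qed
qed

lemma smooth_cone_simplicial: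
  assumes "smooth_fan \<Sigma>" "\<sigma> \<in> \<Sigma>"
  shows "\<exists>b d I. lattice_simplicial b d I \<sigma>"
proof -
  obtain B :: "int ^ 'a ^ 'a" and I where B: "invertible B"
    "\<sigma> = convex_cone hull ((\<lambda>i. real_vec (row i B)) ` I)"
    using assms unfolding smooth_fan_def by blast
  obtain d where d: "(\<forall>i j. real_vec (row i B) \<bullet> real_vec (d j) = (if i = j then 1 else 0)) \<and>
      (\<forall>x. x = (\<Sum>i\<in>UNIV. (x \<bullet> real_vec (d i)) *\<^sub>R real_vec (row i B)))"
    using dual_basis_of_invertible[OF B(1)] ..
  note dual = d[THEN conjunct1, rule_format] d[THEN conjunct2, rule_format]
  have "lattice_simplicial (\<lambda>i. row i B) d I \<sigma>"
    unfolding lattice_simplicial_def B(2) convex_cone_hull_basis[OF dual] using d by (intro conjI refl) (rule conjunct1, assumption, rule conjunct2, assumption)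
  then show ?thesis by blast
qed

text \<open>The sum \<open>x + y\<close> is the midpoint of \<open>2 x\<close> and \<open>2 y\<close>.\<close>

lemma convex_cone_face_summand:
  assumes face: "T face_of S" and S: "convex_cone S" and T: "convex_cone T"
    and x: "x \<in> S" "y \<in> S" "x + y \<in> T"
  shows "x \<in> T"
proof (cases "x = y")
  case True
  then have "(1/2) *\<^sub>R (x + x) \<in> T" using x by (intro convex_cone_scaleR[OF T]) auto
  moreover have "(1/2) *\<^sub>R (x + x) = x" unfolding scaleR_2[symmetric] by simp
  ultimately show ?thesis by simp
next
  case False
  have "x + y = (1 - 1/2) *\<^sub>R (2 *\<^sub>R x) + (1/2) *\<^sub>R (2 *\<^sub>R y)" by simp
  then have "x + y \<in> open_segment (2 *\<^sub>R x) (2 *\<^sub>R y)"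
    unfolding in_segment using False by (intro conjI exI[of _ "1/2"]) auto
  moreover have "2 *\<^sub>R x \<in> S" "2 *\<^sub>R y \<in> S" using x by (auto intro: convex_cone_scaleR[OF S])
  ultimately have "2 *\<^sub>R x \<in> T" using face_ofD[OF face] x(3) by blast
  then have "(1/2) *\<^sub>R (2 *\<^sub>R x) \<in> T" by (rule convex_cone_scaleR[OF T, rotated]) simp
  then show ?thesis by simp
qed

text \<open>For each cone \<open>\<sigma>\<close> a basis \<open>b \<sigma>\<close>, its dual \<open>d \<sigma>\<close> and the part \<open>I \<sigma>\<close> that spans \<open>\<sigma>\<close> are fixed.\<close>

locale smooth_complete_fan =
  fixes \<Sigma> :: "(real ^ 'n::finite) set set" and e :: "'r::finite \<Rightarrow> int ^ 'n"
    and b d :: "(real ^ 'n) set \<Rightarrow> 'n \<Rightarrow> int ^ 'n" and I :: "(real ^ 'n) set \<Rightarrow> 'n set"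
  assumes fan: "is_fan \<Sigma>" and complete: "complete_fan \<Sigma>"
    and edges: "bij_betw e UNIV (fan_edges \<Sigma>)"
    and data: "\<And>\<sigma>. \<sigma> \<in> \<Sigma> \<Longrightarrow> lattice_simplicial (b \<sigma>) (d \<sigma>) (I \<sigma>) \<sigma>"
begin

abbreviation "gen \<sigma> i \<equiv> real_vec (b \<sigma> i)"
abbreviation "coord \<sigma> x i \<equiv> x \<bullet> real_vec (d \<sigma> i)"

lemma gen_coord: "\<sigma> \<in> \<Sigma> \<Longrightarrow> coord \<sigma> (gen \<sigma> i) j = (if i = j then 1 else 0)"
  using data[of \<sigma>] by (simp add: lattice_simplicial_def)

lemma expand: "\<sigma> \<in> \<Sigma> \<Longrightarrow> x = (\<Sum>i\<in>UNIV. coord \<sigma> x i *\<^sub>R gen \<sigma> i)"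
  using data[of \<sigma>] by (simp add: lattice_simplicial_def)

lemma mem_cone: "\<sigma> \<in> \<Sigma> \<Longrightarrow> x \<in> \<sigma> \<longleftrightarrow> (\<forall>i. 0 \<le> coord \<sigma> x i \<and> (i \<notin> I \<sigma> \<longrightarrow> coord \<sigma> x i = 0))"
  using data[of \<sigma>] unfolding lattice_simplicial_def by blast

lemma convex_cone_cone: "\<sigma> \<in> \<Sigma> \<Longrightarrow> convex_cone \<sigma>"
  unfolding convex_cone_iff by (auto simp: mem_cone inner_add_left)

lemma gen_in_cone: "\<sigma> \<in> \<Sigma> \<Longrightarrow> i \<in> I \<sigma> \<Longrightarrow> gen \<sigma> i \<in> \<sigma>"
  by (auto simp: mem_cone gen_coord)

lemma expand_inner: "\<sigma> \<in> \<Sigma> \<Longrightarrow> u \<bullet> x = (\<Sum>i\<in>UNIV. coord \<sigma> x i * (u \<bullet> gen \<sigma> i))"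
  by (subst expand[of \<sigma> x]) (simp_all add: inner_sum_right)

lemma gen_primitive:
  assumes "\<sigma> \<in> \<Sigma>"
  shows "primitive_vec (b \<sigma> i)"
proof -
  let ?g = "Gcd (range (\<lambda>l. b \<sigma> i $ l))"
  have "real_of_int (\<Sum>l\<in>UNIV. b \<sigma> i $ l * d \<sigma> i $ l) = 1"
    using gen_coord[OF assms, of i i] by (simp only: real_vec_inner) simp
  then have "(\<Sum>l\<in>UNIV. b \<sigma> i $ l * d \<sigma> i $ l) = 1" by linarith
  moreover have "?g dvd (\<Sum>l\<in>UNIV. b \<sigma> i $ l * d \<sigma> i $ l)"
    by (intro dvd_sum dvd_mult2 Gcd_dvd) auto
  ultimately have "?g dvd 1" by simp
  then show ?thesis unfolding primitive_vec_def by (metis Gcd_int_greater_eq_0 zdvd1_eq abs_of_nonneg)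
qed

lemma face_in_fan: "\<sigma> \<in> \<Sigma> \<Longrightarrow> \<tau> face_of \<sigma> \<Longrightarrow> \<tau> \<noteq> {} \<Longrightarrow> \<tau> \<in> \<Sigma>"
  using fan unfolding is_fan_def by auto

text \<open>The ray through a generator is the face of \<open>\<sigma>\<close> on which all other coordinates vanish, and a member
  of a lattice basis is primitive.\<close>

lemma gen_edge:
  assumes \<sigma>: "\<sigma> \<in> \<Sigma>" and i: "i \<in> I \<sigma>"
  shows "b \<sigma> i \<in> fan_edges \<Sigma>"
proof -
  have ray: "convex_cone hull {gen \<sigma> i} = {x. \<forall>j. 0 \<le> coord \<sigma> x j \<and> (j \<notin> {i} \<longrightarrow> coord \<sigma> x j = 0)}"
    using convex_cone_hull_basis[of "gen \<sigma>" "\<lambda>j. real_vec (d \<sigma> j)" "{i}"] gen_coord[OF \<sigma>] expand[OF \<sigma>]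
    by simp
  have "convex_cone hull {gen \<sigma> i} face_of \<sigma>"
    unfolding face_of_def
  proof (intro conjI ballI impI)
    show "convex_cone hull {gen \<sigma> i} \<subseteq> \<sigma>"
      using i by (auto simp: ray mem_cone[OF \<sigma>])
    show "convex (convex_cone hull {gen \<sigma> i})" by (rule convex_convex_cone_hull)
    fix x y z assume xy: "x \<in> \<sigma>" "y \<in> \<sigma>" and z: "z \<in> convex_cone hull {gen \<sigma> i}" "z \<in> open_segment x y"
    obtain t where t: "0 < t" "t < 1" "z = (1 - t) *\<^sub>R x + t *\<^sub>R y"
      using z(2) by (auto simp: in_segment)
    have "coord \<sigma> x j = 0 \<and> coord \<sigma> y j = 0" if "j \<noteq> i" for j
    proof -
      have "(1 - t) * coord \<sigma> x j + t * coord \<sigma> y j = 0"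
        using z(1) that by (simp add: ray t(3) inner_add_left)
      moreover have "0 \<le> coord \<sigma> x j" "0 \<le> coord \<sigma> y j" using xy by (auto simp: mem_cone[OF \<sigma>])
      ultimately have "(1 - t) * coord \<sigma> x j = 0 \<and> t * coord \<sigma> y j = 0"
        using t by (subst (asm) add_nonneg_eq_0_iff) auto
      then show ?thesis using t by auto
    qed
    then show "x \<in> convex_cone hull {gen \<sigma> i}" "y \<in> convex_cone hull {gen \<sigma> i}"
      using xy by (auto simp: ray mem_cone[OF \<sigma>])
  qed
  then have "convex_cone hull {gen \<sigma> i} \<in> \<Sigma>"
    using face_in_fan[OF \<sigma>] convex_cone_hull_nonempty by blast
  then show ?thesis using gen_primitive[OF \<sigma>] by (simp add: fan_edges_def)
qed

text \<open>Cones meet in common faces, and a face that contains a sum of vectors of the cone contains the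
  summands.\<close>

lemma gen_in_other_cone:
  assumes \<sigma>: "\<sigma> \<in> \<Sigma>" and \<tau>: "\<tau> \<in> \<Sigma>" and x: "x \<in> \<sigma>" "x \<in> \<tau>" and i: "0 < coord \<sigma> x i"
  shows "gen \<sigma> i \<in> \<tau>"
proof -
  have face: "(\<sigma> \<inter> \<tau>) face_of \<sigma>" using fan \<sigma> \<tau> by (auto simp: is_fan_def)
  have cc: "convex_cone (\<sigma> \<inter> \<tau>)"
    using convex_cone_cone[OF \<sigma>] convex_cone_cone[OF \<tau>] by (auto simp: convex_cone_iff)
  define y where "y = coord \<sigma> x i *\<^sub>R gen \<sigma> i"
  have ci: "coord \<sigma> y j = (if j = i then coord \<sigma> x i else 0)" for j
    by (simp add: y_def gen_coord[OF \<sigma>])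
  have "i \<in> I \<sigma>" using x(1) i by (auto simp: mem_cone[OF \<sigma>])
  then have "y \<in> \<sigma>" "x - y \<in> \<sigma>"
    using x(1) by (auto simp: mem_cone[OF \<sigma>] ci inner_diff_left)
  then have "y \<in> \<sigma> \<inter> \<tau>"
    using x by (intro convex_cone_face_summand[OF face convex_cone_cone[OF \<sigma>] cc, of y "x - y"]) auto
  then have "(1 / coord \<sigma> x i) *\<^sub>R y \<in> \<sigma> \<inter> \<tau>" using i by (intro convex_cone_scaleR[OF cc]) auto
  then show ?thesis using i by (simp add: y_def)
qed

text \<open>Applied to the ray of \<open>v\<close>, the previous lemma puts a generator of \<open>\<sigma>\<close> on this ray. As \<open>v\<close> has an
  integer coordinate \<open>N\<close> with respect to it, \<open>v\<close> is \<open>N\<close> times the generator, and primitivity gives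
  \<open>N = 1\<close>.\<close>

lemma edge_in_cone:
  assumes \<sigma>: "\<sigma> \<in> \<Sigma>" and v: "v \<in> fan_edges \<Sigma>" "real_vec v \<in> \<sigma>"
  shows "\<exists>i\<in>I \<sigma>. v = b \<sigma> i"
proof -
  let ?\<rho> = "convex_cone hull {real_vec v}"
  have \<rho>: "?\<rho> \<in> \<Sigma>" and prim: "Gcd (range (\<lambda>i. v $ i)) = 1"
    using v(1) by (auto simp: fan_edges_def primitive_vec_def)
  have "v \<noteq> 0" using prim by auto
  then have "real_vec v \<noteq> 0" by (simp add: real_vec_def vec_eq_iff)
  then obtain i where "coord \<sigma> (real_vec v) i \<noteq> 0"
    using expand[OF \<sigma>, of "real_vec v"] by (metis (no_types, lifting) scaleR_zero_left sum.neutral)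
  then have i: "0 < coord \<sigma> (real_vec v) i" "i \<in> I \<sigma>"
    using v(2) by (auto simp: mem_cone[OF \<sigma>] less_le)
  have "gen \<sigma> i \<in> ?\<rho>"
    by (rule gen_in_other_cone[OF \<sigma> \<rho> v(2) _ i(1)]) (simp add: hull_inc)
  moreover have "?\<rho> \<subseteq> {t *\<^sub>R real_vec v |t. 0 \<le> t}"
  proof (rule hull_minimal)
    show "{real_vec v} \<subseteq> {t *\<^sub>R real_vec v |t. 0 \<le> t}" by (auto intro: exI[of _ 1])
    show "convex_cone {t *\<^sub>R real_vec v |t. 0 \<le> t}"
      unfolding convex_cone_iff
    proof (intro conjI ballI allI impI)
      show "0 \<in> {t *\<^sub>R real_vec v |t. 0 \<le> t}" by (auto intro: exI[of _ 0])
    next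
      fix x y assume "x \<in> {t *\<^sub>R real_vec v |t. 0 \<le> t}" "y \<in> {t *\<^sub>R real_vec v |t. 0 \<le> t}"
      then obtain s t where "x = s *\<^sub>R real_vec v" "y = t *\<^sub>R real_vec v" "0 \<le> s" "0 \<le> t" by auto
      then have "x + y = (s + t) *\<^sub>R real_vec v" "0 \<le> s + t" by (auto simp: scaleR_add_left)
      then show "x + y \<in> {t *\<^sub>R real_vec v |t. 0 \<le> t}" by blast
    next
      fix x and c :: real assume "x \<in> {t *\<^sub>R real_vec v |t. 0 \<le> t}" "0 \<le> c"
      then obtain t where "x = t *\<^sub>R real_vec v" "0 \<le> t" by auto
      then have "c *\<^sub>R x = (c * t) *\<^sub>R real_vec v" "0 \<le> c * t" using \<open>0 \<le> c\<close> by auto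
      then show "c *\<^sub>R x \<in> {t *\<^sub>R real_vec v |t. 0 \<le> t}" by blast
    qed
  qed
  ultimately obtain t where t: "gen \<sigma> i = t *\<^sub>R real_vec v" "0 \<le> t" by blast
  define N where "N = (\<Sum>l\<in>UNIV. v $ l * d \<sigma> i $ l)"
  have N: "coord \<sigma> (real_vec v) i = of_int N" by (simp only: real_vec_inner N_def)
  have tN: "t * of_int N = 1" using gen_coord[OF \<sigma>, of i i] by (simp add: t N)
  then have "real_vec v = of_int N *\<^sub>R gen \<sigma> i" by (simp add: t mult.commute)
  then have "real_of_int (v $ l) = of_int (N * b \<sigma> i $ l)" for l
    by (simp add: real_vec_def vec_eq_iff)
  then have vl: "v $ l = N * b \<sigma> i $ l" for l by (simp only: of_int_eq_iff)
  then have "N dvd Gcd (range (\<lambda>i. v $ i))" by (intro Gcd_greatest) auto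
  then have "N = 1" using prim i(1) by (auto simp: N)
  then show ?thesis using vl i(2) by (auto simp: vec_eq_iff)
qed

definition idx :: "(real ^ 'n) set \<Rightarrow> 'n \<Rightarrow> 'r" where
  "idx \<sigma> i = inv e (b \<sigma> i)"

lemma e_idx: "\<sigma> \<in> \<Sigma> \<Longrightarrow> i \<in> I \<sigma> \<Longrightarrow> e (idx \<sigma> i) = b \<sigma> i"
  unfolding idx_def using gen_edge edges by (metis bij_betw_imp_surj_on f_inv_into_f)

lemma inj_e: "inj e"
  using edges by (simp add: bij_betw_def)

lemma e_edge: "e r \<in> fan_edges \<Sigma>"
  using edges by (auto simp: bij_betw_def)

text \<open>The linear form with values \<open>y\<close> on the generators of \<open>\<sigma>\<close>, and \<open>0\<close> on the remaining vectors of the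
  chosen basis if \<open>\<sigma>\<close> is not of full dimension.\<close>

definition cone_functional :: "real ^ 'r \<Rightarrow> (real ^ 'n) set \<Rightarrow> real ^ 'n" where
  "cone_functional y \<sigma> = (\<Sum>i\<in>I \<sigma>. y $ idx \<sigma> i *\<^sub>R real_vec (d \<sigma> i))"

lemma cone_functional_gen:
  assumes "\<sigma> \<in> \<Sigma>" "i \<in> I \<sigma>"
  shows "cone_functional y \<sigma> \<bullet> gen \<sigma> i = y $ idx \<sigma> i"
proof -
  have "cone_functional y \<sigma> \<bullet> gen \<sigma> i = (\<Sum>j\<in>I \<sigma>. if j = i then y $ idx \<sigma> j else 0)"
    unfolding cone_functional_def inner_sum_left using gen_coord[OF assms(1), of i]
    by (intro sum.cong) (auto simp: inner_commute)
  then show ?thesis using assms(2) by simp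
qed

lemma cone_functional_edge:
  assumes "\<sigma> \<in> \<Sigma>" "real_vec (e r) \<in> \<sigma>"
  shows "cone_functional y \<sigma> \<bullet> real_vec (e r) = y $ r"
proof -
  obtain i where i: "i \<in> I \<sigma>" "e r = b \<sigma> i" using edge_in_cone[OF assms(1) e_edge assms(2)] by blast
  have "idx \<sigma> i = r" by (rule injD[OF inj_e]) (simp add: e_idx[OF assms(1) i(1)] i(2))
  then show ?thesis using cone_functional_gen[OF assms(1) i(1)] i(2) by simp
qed

text \<open>A linear form is determined at \<open>x \<in> \<sigma>\<close> by its values on the generators with positive coordinate,
  and these belong to every cone that contains \<open>x\<close>.\<close>

lemma linear_on_cone:
  assumes \<sigma>: "\<sigma> \<in> \<Sigma>" and x: "x \<in> \<sigma>"
    and "\<And>r. real_vec (e r) \<in> \<sigma> \<Longrightarrow> (\<forall>\<tau>\<in>\<Sigma>. x \<in> \<tau> \<longrightarrow> real_vec (e r) \<in> \<tau>) \<Longrightarrow> u \<bullet> real_vec (e r) = w \<bullet> real_vec (e r)"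
  shows "u \<bullet> x = w \<bullet> x"
  unfolding expand_inner[OF \<sigma>, of _ x]
proof (rule sum.cong[OF refl])
  fix i
  show "coord \<sigma> x i * (u \<bullet> gen \<sigma> i) = coord \<sigma> x i * (w \<bullet> gen \<sigma> i)"
  proof (cases "coord \<sigma> x i = 0")
    case False
    then have i: "0 < coord \<sigma> x i" "i \<in> I \<sigma>" using x by (auto simp: mem_cone[OF \<sigma>] less_le)
    have "u \<bullet> real_vec (e (idx \<sigma> i)) = w \<bullet> real_vec (e (idx \<sigma> i))"
      by (rule assms(3))
        (use e_idx[OF \<sigma> i(2)] gen_in_cone[OF \<sigma> i(2)] gen_in_other_cone[OF \<sigma> _ x _ i(1)] in auto)
    then show ?thesis using e_idx[OF \<sigma> i(2)] by simp
  qed simp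
qed

lemma cone_functional_consistent:
  assumes "\<sigma> \<in> \<Sigma>" "\<tau> \<in> \<Sigma>" "x \<in> \<sigma>" "x \<in> \<tau>"
  shows "cone_functional y \<sigma> \<bullet> x = cone_functional y \<tau> \<bullet> x"
  by (rule linear_on_cone[OF assms(1,3)]) (use assms cone_functional_edge in auto)

definition chosen_cone :: "real ^ 'n \<Rightarrow> (real ^ 'n) set" where
  "chosen_cone x = (SOME \<sigma>. \<sigma> \<in> \<Sigma> \<and> x \<in> \<sigma>)"

lemma chosen_cone: "chosen_cone x \<in> \<Sigma>" "x \<in> chosen_cone x"
proof -
  have "\<exists>\<sigma>. \<sigma> \<in> \<Sigma> \<and> x \<in> \<sigma>" using complete by (auto simp: complete_fan_def)
  from someI_ex[OF this] show "chosen_cone x \<in> \<Sigma>" "x \<in> chosen_cone x"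
    by (auto simp: chosen_cone_def)
qed

text \<open>The piecewise linear function with values \<open>y\<close> on the edges. Using one cone for each vector is harmless
  because the linear forms of different cones agree where the cones meet.\<close>

definition pl_ext :: "real ^ 'r \<Rightarrow> real ^ 'n \<Rightarrow> real" where
  "pl_ext y x = cone_functional y (chosen_cone x) \<bullet> x"

lemma pl_ext_eq: "\<sigma> \<in> \<Sigma> \<Longrightarrow> x \<in> \<sigma> \<Longrightarrow> pl_ext y x = cone_functional y \<sigma> \<bullet> x"
  unfolding pl_ext_def by (intro cone_functional_consistent chosen_cone)

lemma full_dim:
  assumes \<sigma>: "\<sigma> \<in> \<Sigma>" and dim: "dim \<sigma> = CARD('n)"
  shows "I \<sigma> = UNIV"
proof (rule ccontr)
  assume "I \<sigma> \<noteq> UNIV"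
  then obtain j where "j \<notin> I \<sigma>" by blast
  then have "\<sigma> \<subseteq> {x. real_vec (d \<sigma> j) \<bullet> x = 0}" by (auto simp: mem_cone[OF \<sigma>] inner_commute)
  then have "dim \<sigma> \<le> dim {x. real_vec (d \<sigma> j) \<bullet> x = 0}" by (rule dim_subset)
  also have "\<dots> = CARD('n) - 1"
  proof -
    have "real_vec (d \<sigma> j) \<noteq> 0" using gen_coord[OF \<sigma>, of j j] by auto
    then show ?thesis using dim_hyperplane by (metis DIM_cart DIM_real mult_1_right)
  qed
  finally have "CARD('n) \<le> CARD('n) - 1" unfolding dim .
  moreover have "CARD('n) - 1 < CARD('n)"
    by (rule diff_less[OF zero_less_one]) (simp add: card_gt_0_iff)
  ultimately show False by (meson leD)
qed

text \<open>Strict convexity tested on edges only, and only against the cones of full dimension.\<close>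

definition convex_values :: "(real ^ 'r) set" where
  "convex_values = {y. \<forall>\<sigma>\<in>\<Sigma>. I \<sigma> = UNIV \<longrightarrow>
     (\<forall>r. real_vec (e r) \<notin> \<sigma> \<longrightarrow> y $ r < cone_functional y \<sigma> \<bullet> real_vec (e r))}"

lemma open_convex_values: "open convex_values"
proof -
  have "convex_values = (\<Inter>\<sigma>\<in>{\<sigma>\<in>\<Sigma>. I \<sigma> = UNIV}. \<Inter>r\<in>{r. real_vec (e r) \<notin> \<sigma>}.
      {y. y $ r < cone_functional y \<sigma> \<bullet> real_vec (e r)})"
    by (auto simp: convex_values_def)
  moreover have "finite \<Sigma>" using fan by (simp add: is_fan_def)
  moreover have "open {y. y $ r < cone_functional y \<sigma> \<bullet> real_vec (e r)}" for r \<sigma>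
    unfolding cone_functional_def by (intro open_Collect_less continuous_intros)
  ultimately show ?thesis by (auto intro!: open_INT)
qed

text \<open>Let \<open>u\<close> be the linear form of the full-dimensional cone \<open>\<sigma>\<close>, and expand \<open>v\<close> over the generators of a
  cone \<open>\<tau>\<close> that contains it. On each generator \<open>u\<close> is at least the prescribed value, and
  strictly larger if the generator is outside \<open>\<sigma>\<close>. As \<open>v \<notin> \<sigma>\<close>, some generator outside \<open>\<sigma>\<close> occurs
  in \<open>v\<close>.\<close>

lemma strictly_convex_pl_ext:
  assumes y: "y \<in> convex_values"
  shows "strictly_convex \<Sigma> (pl_ext y)"
  unfolding strictly_convex_def
proof (intro ballI impI allI)
  fix \<sigma> u v
  assume \<sigma>: "\<sigma> \<in> \<Sigma>" and dim: "dim \<sigma> = CARD('n)"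
    and u: "\<forall>x\<in>\<sigma>. pl_ext y x = u \<bullet> x" and v: "v \<notin> \<sigma>"
  have full: "I \<sigma> = UNIV" by (rule full_dim[OF \<sigma> dim])
  have ext: "pl_ext y (real_vec (e r)) = y $ r" for r
    unfolding pl_ext_def by (intro cone_functional_edge chosen_cone)
  have us: "u \<bullet> x = cone_functional y \<sigma> \<bullet> x" for x
    unfolding expand_inner[OF \<sigma>, of _ x]
    using u gen_in_cone[OF \<sigma>] pl_ext_eq[OF \<sigma>] full by (intro sum.cong) auto
  have edge: "y $ r \<le> u \<bullet> real_vec (e r)" "real_vec (e r) \<notin> \<sigma> \<Longrightarrow> y $ r < u \<bullet> real_vec (e r)" for r
  proof -
    show lt: "y $ r < u \<bullet> real_vec (e r)" if "real_vec (e r) \<notin> \<sigma>"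
      using y \<sigma> full that us unfolding convex_values_def by auto
    show "y $ r \<le> u \<bullet> real_vec (e r)"
      using lt u ext[of r] by (cases "real_vec (e r) \<in> \<sigma>") auto
  qed
  define \<tau> where "\<tau> = chosen_cone v"
  have \<tau>: "\<tau> \<in> \<Sigma>" "v \<in> \<tau>" unfolding \<tau>_def by (rule chosen_cone)+
  have term_le: "coord \<tau> v i * (cone_functional y \<tau> \<bullet> gen \<tau> i) \<le> coord \<tau> v i * (u \<bullet> gen \<tau> i)" for i
  proof (cases "i \<in> I \<tau>")
    case True
    then show ?thesis
      using edge(1)[of "idx \<tau> i"] \<tau> e_idx[OF \<tau>(1) True] cone_functional_gen[OF \<tau>(1) True]
      by (intro mult_left_mono) (auto simp: mem_cone)
  next
    case False
    then show ?thesis using \<tau> by (simp add: mem_cone)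
  qed
  have "\<exists>i. 0 < coord \<tau> v i \<and> gen \<tau> i \<notin> \<sigma>"
  proof (rule ccontr)
    assume *: "\<not> ?thesis"
    have "coord \<tau> v i *\<^sub>R gen \<tau> i \<in> \<sigma>" for i
    proof (cases "coord \<tau> v i = 0")
      case True
      then show ?thesis using convex_cone_contains_0[OF convex_cone_cone[OF \<sigma>]] by simp
    next
      case False
      then have "0 < coord \<tau> v i" using \<tau> by (auto simp: mem_cone less_le)
      then show ?thesis using * by (intro convex_cone_scaleR[OF convex_cone_cone[OF \<sigma>]]) auto
    qed
    then have "(\<Sum>i\<in>UNIV. coord \<tau> v i *\<^sub>R gen \<tau> i) \<in> \<sigma>"
      by (intro convex_cone_sum[OF convex_cone_cone[OF \<sigma>]]) auto
    then show False using v by (simp flip: expand[OF \<tau>(1)])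
  qed
  then obtain i where i: "0 < coord \<tau> v i" "gen \<tau> i \<notin> \<sigma>" by blast
  then have iI: "i \<in> I \<tau>" using \<tau> by (auto simp: mem_cone)
  have "cone_functional y \<tau> \<bullet> v < u \<bullet> v"
    unfolding expand_inner[OF \<tau>(1), of _ v]
  proof (rule sum_strict_mono_ex1)
    show "\<exists>i\<in>UNIV. coord \<tau> v i * (cone_functional y \<tau> \<bullet> gen \<tau> i) < coord \<tau> v i * (u \<bullet> gen \<tau> i)"
      using edge(2)[of "idx \<tau> i"] i e_idx[OF \<tau>(1) iI] cone_functional_gen[OF \<tau>(1) iI]
      by (intro bexI[of _ i] mult_strict_left_mono) auto
  qed (use term_le in auto)
  then show "pl_ext y v < u \<bullet> v" by (simp add: pl_ext_def \<tau>_def)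
qed

lemma toric_form_values_eq: "toric_form_values \<Sigma> e = convex_values"
proof (intro equalityI subsetI)
  fix y assume "y \<in> convex_values"
  then have "strictly_convex \<Sigma> (pl_ext y)" by (rule strictly_convex_pl_ext)
  moreover have "piecewise_linear \<Sigma> (pl_ext y)"
    unfolding piecewise_linear_def
  proof
    fix \<sigma> assume "\<sigma> \<in> \<Sigma>"
    then show "\<exists>u. \<forall>v\<in>\<sigma>. pl_ext y v = u \<bullet> v"
      by (intro exI[of _ "cone_functional y \<sigma>"]) (simp add: pl_ext_eq)
  qed
  moreover have "pl_ext y (real_vec (e r)) = y $ r" for r
    unfolding pl_ext_def by (intro cone_functional_edge chosen_cone)
  ultimately show "y \<in> toric_form_values \<Sigma> e"
    unfolding toric_form_values_def toric_symplectic_def by (auto intro!: exI[of _ "pl_ext y"])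
next
  fix y assume "y \<in> toric_form_values \<Sigma> e"
  then obtain F where pl: "piecewise_linear \<Sigma> F" and sc: "strictly_convex \<Sigma> F"
    and F: "\<And>r. y $ r = F (real_vec (e r))"
    unfolding toric_form_values_def toric_symplectic_def by auto
  show "y \<in> convex_values"
    unfolding convex_values_def
  proof (intro CollectI ballI impI allI)
    fix \<sigma> r assume \<sigma>: "\<sigma> \<in> \<Sigma>" and full: "I \<sigma> = UNIV" and r: "real_vec (e r) \<notin> \<sigma>"
    obtain u where u: "\<forall>x\<in>\<sigma>. F x = u \<bullet> x" using pl \<sigma> unfolding piecewise_linear_def by blast
    have us: "\<forall>x\<in>\<sigma>. F x = cone_functional y \<sigma> \<bullet> x"
    proof
      fix x assume x: "x \<in> \<sigma>"
      have "u \<bullet> x = cone_functional y \<sigma> \<bullet> x"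
        by (rule linear_on_cone[OF \<sigma> x]) (use u F cone_functional_edge[OF \<sigma>] in simp)
      then show "F x = cone_functional y \<sigma> \<bullet> x" using u x by simp
    qed
    have "gen \<sigma> ` UNIV \<subseteq> \<sigma>" using gen_in_cone[OF \<sigma>] full by auto
    then have "(\<Sum>i\<in>UNIV. coord \<sigma> x i *\<^sub>R gen \<sigma> i) \<in> span \<sigma>" for x
      by (intro span_sum span_scale span_base) auto
    then have "x \<in> span \<sigma>" for x by (simp flip: expand[OF \<sigma>])
    then have "span \<sigma> = UNIV" by auto
    then have "dim \<sigma> = dim (UNIV :: (real ^ 'n) set)" by (metis dim_span)
    then have "dim \<sigma> = CARD('n)" by simp
    then show "y $ r < cone_functional y \<sigma> \<bullet> real_vec (e r)"
      using sc \<sigma> us r F unfolding strictly_convex_def by auto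
  qed
qed

text \<open>Cones of smaller dimension lie in hyperplanes, and finitely many hyperplanes do not cover the
  space.\<close>

lemma full_cone_exists: "\<exists>\<sigma>\<in>\<Sigma>. I \<sigma> = UNIV"
proof (rule ccontr)
  assume none: "\<not> ?thesis"
  have "negligible (\<Union>\<Sigma>)"
  proof (rule negligible_Union)
    show "finite \<Sigma>" using fan by (simp add: is_fan_def)
    fix \<sigma> assume \<sigma>: "\<sigma> \<in> \<Sigma>"
    then obtain j where "j \<notin> I \<sigma>" using none by blast
    then have "\<sigma> \<subseteq> {x. real_vec (d \<sigma> j) \<bullet> x = 0}" by (auto simp: mem_cone[OF \<sigma>] inner_commute)
    moreover have "real_vec (d \<sigma> j) \<noteq> 0" using gen_coord[OF \<sigma>, of j j] by auto
    then have "negligible {x. real_vec (d \<sigma> j) \<bullet> x = 0}" by (intro negligible_hyperplane) simp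
    ultimately show "negligible \<sigma>" by (blast intro: negligible_subset)
  qed
  then show False using complete by (simp add: complete_fan_def)
qed

lemma edges_generate_lattice:
  "\<exists>C. \<forall>j l. (\<Sum>r\<in>UNIV. C j r * e r $ l) = (if j = l then 1 else 0 :: int)"
proof -
  obtain \<sigma> where \<sigma>: "\<sigma> \<in> \<Sigma>" "I \<sigma> = UNIV" using full_cone_exists by blast
  have e_idx': "e (idx \<sigma> i) = b \<sigma> i" for i using e_idx \<sigma> by simp
  have inj: "inj (idx \<sigma>)"
  proof (rule injI)
    fix i j assume "idx \<sigma> i = idx \<sigma> j"
    then have "b \<sigma> i = b \<sigma> j" by (metis e_idx')
    then show "i = j" using gen_coord[OF \<sigma>(1), of i j] gen_coord[OF \<sigma>(1), of j j] by (auto split: if_splits)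
  qed
  define C where "C j r = (if r \<in> range (idx \<sigma>) then d \<sigma> (inv (idx \<sigma>) r) $ j else 0)" for j r
  have "(\<Sum>r\<in>UNIV. C j r * e r $ l) = (if j = l then 1 else 0)" for j l
  proof -
    have "(\<Sum>r\<in>UNIV. C j r * e r $ l) = (\<Sum>r\<in>range (idx \<sigma>). C j r * e r $ l)"
      by (rule sum.mono_neutral_right) (auto simp: C_def)
    also have "\<dots> = (\<Sum>i\<in>UNIV. d \<sigma> i $ j * b \<sigma> i $ l)"
      by (subst sum.reindex[OF inj]) (simp add: C_def inj e_idx')
    finally have 1: "(\<Sum>r\<in>UNIV. C j r * e r $ l) = (\<Sum>i\<in>UNIV. d \<sigma> i $ j * b \<sigma> i $ l)" .
    have "(axis j 1 :: real ^ 'n) $ l = (\<Sum>i\<in>UNIV. coord \<sigma> (axis j 1) i *\<^sub>R gen \<sigma> i) $ l"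
      by (simp flip: expand[OF \<sigma>(1)])
    moreover have "coord \<sigma> (axis j 1) i = of_int (d \<sigma> i $ j)" for i
      by (simp add: inner_axis' real_vec_def)
    ultimately have "(if j = l then 1 else 0) = (\<Sum>i\<in>UNIV. real_of_int (d \<sigma> i $ j) * of_int (b \<sigma> i $ l))"
      by (simp add: real_vec_def axis_def eq_commute)
    then have "real_of_int (\<Sum>i\<in>UNIV. d \<sigma> i $ j * b \<sigma> i $ l) = of_int (if j = l then 1 else 0)"
      by (auto split: if_splits)
    then show ?thesis unfolding 1 by (simp only: of_int_eq_iff)
  qed
  then show ?thesis by blast
qed

end

section \<open>Genericity\<close>

theorem lemma1p12:
  fixes \<Sigma> :: "(real ^ 'n::finite) set set"
    and e :: "'r::finite \<Rightarrow> int ^ 'n"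
  assumes "smooth_fano_fan \<Sigma>"
    and "bij_betw e UNIV (fan_edges \<Sigma>)"
  shows "generic_on (toric_form_values \<Sigma> e)
           (\<lambda>x. let W = (superpotential e x :: ('n, 'k::field_char_0 novikov fls) laurent_poly) in
                morse W \<and>
                inj_on (laurent_eval W) (critical_points W) \<and>
                (\<forall>p\<in>critical_points W. laurent_eval W p \<noteq> 0))"
proof -
  have "\<forall>\<sigma>. \<exists>b d I. \<sigma> \<in> \<Sigma> \<longrightarrow> lattice_simplicial b d I \<sigma>"
    using smooth_cone_simplicial assms(1) unfolding smooth_fano_fan_def by blast
  then obtain b d I where "\<And>\<sigma>. \<sigma> \<in> \<Sigma> \<Longrightarrow> lattice_simplicial (b \<sigma>) (d \<sigma>) (I \<sigma>) \<sigma>" by metis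
  then interpret smooth_complete_fan \<Sigma> e b d I
    using assms by unfold_locales (auto simp: smooth_fano_fan_def)
  obtain C where C: "\<And>j l. (\<Sum>i\<in>UNIV. C j i * e i $ l) = (if j = l then 1 else 0)"
    using edges_generate_lattice by blast
  obtain k where k: "\<And>x. x \<in> off_hyperplanes k \<Longrightarrow> morse_coeffs e (edge_coeffs x :: 'k novikov fls ^ 'r)"
    using morse_coeffs_off_hyperplanes[OF C] by blast
  let ?A = "toric_form_values \<Sigma> e"
  have "open ?A" unfolding toric_form_values_eq by (rule open_convex_values)
  show ?thesis
    unfolding generic_on_def Let_def
  proof (intro exI[of _ "?A \<inter> off_hyperplanes k"] conjI ballI)
    show "openin (top_of_set ?A) (?A \<inter> off_hyperplanes k)"
      by (rule openin_open_Int[OF open_off_hyperplanes])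
    show "?A \<subseteq> closure (?A \<inter> off_hyperplanes k)"
      by (rule open_subset_closure_off_hyperplanes[OF \<open>open ?A\<close>])
  qed (use superpotential_morse_distinct_nonzero[OF k] in auto)
qed

end
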